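(* Let $G$ be a finite group, $H\le G$ a subgroup, and let $w\in\mathbb{C}[G]$ be an irreducible weakly lumping weight. For each probability distribution $\alpha$ on $G$, the Markov chain $\mathrm{MC}(\alpha,w)$ lumps weakly to $G/H$ if and only if $\alpha\in J_w$.
   Context: A weight on $G$ is a function $w : G \to \mathbb{R}_{\ge 0}$ that is not identically zero; write $w(K) = \sum_{g\in K} w(g)$. Functions $x: G \to \mathbb{C}$ are identified with elements $\sum_g x(g) g \in \mathbb{C}[G]$. The weight $w$ is irreducible if its support generates $G$. $\mathrm{MC}(\alpha,w)$ is the time-homogeneous Markov chain $(X_t)_{t\ge 0}$ on $G$ with $X_0$ distributed as $\alpha$ and $\mathbb{P}[X_{t+1} = xg \mid X_t = x] = w(g)/w(G)$. It lumps weakly to $G/H$ if $(X_tH)_{t\ge 0}$ is a time-homogeneous Markov chain on the set $G/H$ of left cosets. The weight $w$ is weakly lumping if $\mathrm{MC}(\alpha,w)$ lumps weakly to $G/H$ for some $\alpha$. For non-empty $K \subseteq G$, $\eta_K = |K|^{-1}\sum_{g\in K} g$. Let $\pi_H : \mathbb{C}[G]\to\mathbb{C}[H]$ be the projection $\sum_{g\in G} x(g) g \mapsto \sum_{g\in H} x(g) g$. A Gurvits--Ledoux ideal for $w$ is a left ideal $L$ of $\mathbb{C}[G]$ with $\eta_G\in L$, $Lw\subseteq L$ and $\pi_H(L)\subseteq L$. When $w$ is irreducible and weakly lumping, $J_w$ denotes the (unique) maximal Gurvits--Ledoux ideal $L$ for $w$ satisfying $L(1-\eta_H)w\eta_H =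 0$, i.e. the one containing all others with this property. *)

theory Defs
  imports "HOL-Algebra.Ideal" "HOL-Algebra.Left_Coset" "HOL-Algebra.Generated_Groups"
    "HOL-Probability.Probability"
begin

section \<open>The group algebra\<close>

text \<open>
  The group algebra of a finite group \<open>G\<close> over the complex numbers. The element
  \<open>\<Sum>g. x(g) g\<close> is the coefficient function \<open>x\<close>, set to \<open>0\<close> outside the carrier of \<open>G\<close>, so
  multiplication is convolution: \<open>(x y)(g)\<close> is the sum of \<open>x(h) y(k)\<close> over \<open>h k = g\<close>.
\<close>

definition group_algebra :: "('a, 'b) monoid_scheme \<Rightarrow> ('a \<Rightarrow> complex) ring" where
  "group_algebra G =
    \<lparr> carrier = {x. \<forall>g. g \<notin> carrier G \<longrightarrow> x g = 0},
      monoid.mult = (\<lambda>x y g. if g \<in> carrier G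
                then \<Sum>h\<in>carrier G. x h * y (inv\<^bsub>G\<^esub> h \<otimes>\<^bsub>G\<^esub> g) else 0),
      monoid.one = (\<lambda>g. if g = \<one>\<^bsub>G\<^esub> then 1 else 0),
      ring.zero = (\<lambda>g. 0),
      ring.add = (\<lambda>x y g. x g + y g) \<rparr>"

definition real_elem :: "('a, 'b) monoid_scheme \<Rightarrow> ('a \<Rightarrow> real) \<Rightarrow> 'a \<Rightarrow> complex" where
  "real_elem G f = (\<lambda>g. if g \<in> carrier G then complex_of_real (f g) else 0)"

definition eta :: "'a set \<Rightarrow> 'a \<Rightarrow> complex" where
  "eta K = (\<lambda>g. if g \<in> K then 1 / of_nat (card K) else 0)"

text \<open>The projection to the group algebra of \<open>H\<close>, viewed inside the group algebra of \<open>G\<close>.\<close>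

definition proj :: "'a set \<Rightarrow> ('a \<Rightarrow> complex) \<Rightarrow> 'a \<Rightarrow> complex" where
  "proj H x = (\<lambda>g. if g \<in> H then x g else 0)"

text \<open>The \<open>ideal\<close> of the library is two-sided.\<close>

definition left_ideal :: "'c set \<Rightarrow> ('c, 'd) ring_scheme \<Rightarrow> bool" where
  "left_ideal L R \<longleftrightarrow>
     additive_subgroup L R \<and> (\<forall>r\<in>carrier R. \<forall>x\<in>L. r \<otimes>\<^bsub>R\<^esub> x \<in> L)"

section \<open>Weights\<close>

text \<open>Values of \<open>w\<close> outside the carrier of \<open>G\<close> are irrelevant throughout.\<close>

definition weight :: "('a, 'b) monoid_scheme \<Rightarrow> ('a \<Rightarrow> real) \<Rightarrow> bool" where
  "weight G w \<longleftrightarrow> (\<forall>g\<in>carrier G. 0 \<le> w g) \<and> (\<exists>g\<in>carrier G. w g \<noteq> 0)"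

definition irreducible_weight :: "('a, 'b) monoid_scheme \<Rightarrow> ('a \<Rightarrow> real) \<Rightarrow> bool" where
  "irreducible_weight G w \<longleftrightarrow> generate G {g \<in> carrier G. w g \<noteq> 0} = carrier G"

section \<open>Markov chains and weak lumping\<close>

text \<open>
  \<open>Y\<close> is a time-homogeneous Markov chain on the finite state space \<open>S\<close> with transition
  matrix \<open>P\<close>; the Markov property is required only for histories of positive probability.
\<close>

definition markov_chain ::
  "'o measure \<Rightarrow> 's set \<Rightarrow> (nat \<Rightarrow> 'o \<Rightarrow> 's) \<Rightarrow> ('s \<Rightarrow> 's \<Rightarrow> real) \<Rightarrow> bool" where
  "markov_chain M S Y P \<longleftrightarrow>
     prob_space M \<and> finite S \<and>
     (\<forall>t. Y t \<in> M \<rightarrow>\<^sub>M count_space S) \<and>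
     (\<forall>x\<in>S. (\<forall>y\<in>S. 0 \<le> P x y) \<and> (\<Sum>y\<in>S. P x y) = 1) \<and>
     (\<forall>t. \<forall>y. (\<forall>i\<le>Suc t. y i \<in> S) \<longrightarrow>
        \<P>(\<omega> in M. \<forall>i\<le>t. Y i \<omega> = y i) > 0 \<longrightarrow>
        \<P>(\<omega> in M. Y (Suc t) \<omega> = y (Suc t) \<bar> \<forall>i\<le>t. Y i \<omega> = y i) = P (y t) (y (Suc t)))"

text \<open>\<open>X\<close>, defined on the probability space \<open>M\<close>, is a realisation of \<open>MC(\<alpha>,w)\<close>.\<close>

definition is_MC ::
  "('a, 'b) monoid_scheme \<Rightarrow> 'a pmf \<Rightarrow> ('a \<Rightarrow> real) \<Rightarrow> 'o measure \<Rightarrow> (nat \<Rightarrow> 'o \<Rightarrow> 'a) \<Rightarrow> bool" where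
  "is_MC G \<alpha> w M X \<longleftrightarrow>
     markov_chain M (carrier G) X
       (\<lambda>x y. w (inv\<^bsub>G\<^esub> x \<otimes>\<^bsub>G\<^esub> y) / (\<Sum>g\<in>carrier G. w g)) \<and>
     (\<forall>x\<in>carrier G. \<P>(\<omega> in M. X 0 \<omega> = x) = pmf \<alpha> x)"

text \<open>
  Whether the coset process is a Markov chain depends only on the law of \<open>MC(\<alpha>,w)\<close>, hence
  not on the realisation. The sample space is taken of type \<^typ>\<open>nat \<Rightarrow> 'a\<close>, large enough to
  carry \<open>MC(\<alpha>,w)\<close> as the coordinate process on path space; a definition cannot quantify over
  all types of sample spaces.
\<close>

definition lumps_weakly ::
  "('a, 'b) monoid_scheme \<Rightarrow> 'a set \<Rightarrow> 'a pmf \<Rightarrow> ('a \<Rightarrow> real) \<Rightarrow> bool" where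
  "lumps_weakly G H \<alpha> w \<longleftrightarrow>
     (\<exists>(M :: (nat \<Rightarrow> 'a) measure) X. is_MC G \<alpha> w M X \<and>
        (\<exists>Q. markov_chain M (lcosets\<^bsub>G\<^esub> H) (\<lambda>t \<omega>. X t \<omega> <#\<^bsub>G\<^esub> H) Q))"

definition weakly_lumping ::
  "('a, 'b) monoid_scheme \<Rightarrow> 'a set \<Rightarrow> ('a \<Rightarrow> real) \<Rightarrow> bool" where
  "weakly_lumping G H w \<longleftrightarrow> (\<exists>\<alpha>. set_pmf \<alpha> \<subseteq> carrier G \<and> lumps_weakly G H \<alpha> w)"

section \<open>Gurvits--Ledoux ideals\<close>

definition GL_ideal ::
  "('a, 'b) monoid_scheme \<Rightarrow> 'a set \<Rightarrow> ('a \<Rightarrow> real) \<Rightarrow> ('a \<Rightarrow> complex) set \<Rightarrow> bool" where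
  "GL_ideal G H w L \<longleftrightarrow>
     left_ideal L (group_algebra G) \<and>
     eta (carrier G) \<in> L \<and>
     (\<forall>x\<in>L. x \<otimes>\<^bsub>group_algebra G\<^esub> real_elem G w \<in> L) \<and>
     proj H ` L \<subseteq> L"

definition lumping_GL_ideal ::
  "('a, 'b) monoid_scheme \<Rightarrow> 'a set \<Rightarrow> ('a \<Rightarrow> real) \<Rightarrow> ('a \<Rightarrow> complex) set \<Rightarrow> bool" where
  "lumping_GL_ideal G H w L \<longleftrightarrow>
     GL_ideal G H w L \<and>
     (\<forall>x\<in>L. x \<otimes>\<^bsub>group_algebra G\<^esub> (\<one>\<^bsub>group_algebra G\<^esub> \<ominus>\<^bsub>group_algebra G\<^esub> eta H)
              \<otimes>\<^bsub>group_algebra G\<^esub> real_elem G w \<otimes>\<^bsub>group_algebra G\<^esub> eta H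
            = \<zero>\<^bsub>group_algebra G\<^esub>)"

text \<open>The description is proper when \<open>w\<close> is irreducible and weakly lumping.\<close>

definition J_ideal ::
  "('a, 'b) monoid_scheme \<Rightarrow> 'a set \<Rightarrow> ('a \<Rightarrow> real) \<Rightarrow> ('a \<Rightarrow> complex) set" where
  "J_ideal G H w =
     (THE J. lumping_GL_ideal G H w J \<and> (\<forall>L. lumping_GL_ideal G H w L \<longrightarrow> L \<subseteq> J))"

end

theory Submission
  imports Defs
begin

text \<open>
  Follow the measure \<open>x\<close> through a prescribed sequence of cosets: restrict it to \<open>b\<^sub>0\<close>, multiply
  by \<open>w\<close>, restrict to \<open>b\<^sub>1\<close>, and so on up to \<open>b\<^sub>t\<close>. For \<open>x = \<alpha>\<close> the resulting vector, written
  \<open>hist \<alpha> b t\<close> below, is up to the factor \<open>w(G)\<^sup>t\<close> the law of \<open>X\<^sub>t\<close> on the event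
  \<open>X\<^sub>iH = b\<^sub>i\<close> for all \<open>i \<le> t\<close> (\<open>hist_eq_prob\<close>). A vector \<open>v\<close> carried by one coset satisfies
  \<open>v(1 - \<eta>\<^sub>H)w\<eta>\<^sub>H = 0\<close> exactly when, after one step, its mass is distributed over the cosets as if
  \<open>v\<close> had been uniform on its coset (\<open>mult_defect_eq_zero_iff\<close>).

  Let \<open>J\<close> be the set of all \<open>x\<close> such that every history of \<open>x\<close> satisfies this equation. The theorem
  splits into two claims.

  First, \<open>J\<close> is the maximal ideal \<open>J\<^sub>w\<close>. Left multiplication by a group element only
  translates the cosets of a history, while multiplication by \<open>w\<close> and restriction to \<open>H\<close> turn the
  histories of \<open>x\<close> into sums of longer or equal ones; so \<open>J\<close> is a left ideal stable under both
  operations. Conversely a left ideal stable under restriction to \<open>H\<close> is stable under restriction to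
  every left coset, because \<open>gH\<close> is a translate of \<open>H\<close>; hence a Gurvits--Ledoux ideal contains all
  histories of its elements and, if it satisfies the equation, lies in \<open>J\<close>. What remains is
  \<open>\<eta>\<^sub>G \<in> J\<close>. If \<open>\<beta>\<close> is any probability vector in \<open>J\<close>, then \<open>\<eta>\<^sub>G = \<eta>\<^sub>G\<beta> \<in> J\<close>, and the second
  claim provides such a \<open>\<beta>\<close> since \<open>w\<close> is weakly lumping.

  Second, \<open>MC(\<alpha>,w)\<close> lumps weakly if and only if \<open>\<alpha> \<in> J\<close> (\<open>lumps_weakly_iff_in_J\<close>). If
  \<open>\<alpha> \<in> J\<close>, the coset process is Markov with the transition matrix \<open>Q_unif\<close> obtained from the uniform
  laws on the cosets. For the converse the point is that no other transition matrix \<open>P\<close> can occur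
  (\<open>lumped_transition_unique\<close>): the law \<open>\<mu>\<^sub>t\<close> of \<open>X\<^sub>t\<close> satisfies a linear relation involving
  \<open>P(b,c)\<close> for every \<open>t\<close>, the time averages of \<open>\<mu>\<^sub>t\<close> converge to the uniform law by
  irreducibility (\<open>cesaro_uniform\<close>), and in the limit the relation says \<open>P(b,c) = Q_unif(b,c)\<close>.
\<close>

section \<open>The group algebra as a ring\<close>

locale finite_group = group G for G (structure) +
  assumes finite_carrier [simp]: "finite (carrier G)"
begin

abbreviation A where "A \<equiv> group_algebra G"

lemma carrier_A: "carrier A = {x. \<forall>g. g \<notin> carrier G \<longrightarrow> x g = 0}"
  and mult_A: "x \<otimes>\<^bsub>A\<^esub> y =
    (\<lambda>g. if g \<in> carrier G then \<Sum>h\<in>carrier G. x h * y (inv h \<otimes> g) else 0)"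
  and one_A: "\<one>\<^bsub>A\<^esub> = (\<lambda>g. if g = \<one> then 1 else 0)"
  and zero_A: "\<zero>\<^bsub>A\<^esub> = (\<lambda>g. 0)"
  and add_A: "x \<oplus>\<^bsub>A\<^esub> y = (\<lambda>g. x g + y g)"
  by (simp_all add: group_algebra_def)

lemmas A_defs = carrier_A mult_A one_A zero_A add_A

lemma cancel_inverse [simp]:
  assumes "g \<in> carrier G" "a \<in> carrier G"
  shows "g \<otimes> (inv g \<otimes> a) = a" "inv g \<otimes> (g \<otimes> a) = a"
  using assms by (simp_all add: m_assoc[symmetric])

lemma sum_translate:
  assumes "h \<in> carrier G"
  shows "(\<Sum>k\<in>carrier G. f (h \<otimes> k)) = (\<Sum>k\<in>carrier G. f k)"
  by (rule sum.reindex_bij_witness[of _ "\<lambda>k. inv h \<otimes> k" "\<lambda>k. h \<otimes> k"])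
     (use assms in \<open>auto\<close>)

lemma sum_inverse_translate:
  assumes "g \<in> carrier G"
  shows "(\<Sum>k\<in>carrier G. f (inv k \<otimes> g)) = (\<Sum>k\<in>carrier G. f k)"
  by (rule sum.reindex_bij_witness[of _ "\<lambda>k. g \<otimes> inv k" "\<lambda>k. inv k \<otimes> g"])
     (use assms in \<open>auto simp: m_assoc inv_mult_group\<close>)

lemma A_assoc: "(x \<otimes>\<^bsub>A\<^esub> y) \<otimes>\<^bsub>A\<^esub> z = x \<otimes>\<^bsub>A\<^esub> (y \<otimes>\<^bsub>A\<^esub> z)"
proof
  fix g
  show "((x \<otimes>\<^bsub>A\<^esub> y) \<otimes>\<^bsub>A\<^esub> z) g = (x \<otimes>\<^bsub>A\<^esub> (y \<otimes>\<^bsub>A\<^esub> z)) g"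
  proof (cases "g \<in> carrier G")
    case g: True
    have inner: "(\<Sum>k\<in>carrier G. y (inv h \<otimes> k) * z (inv k \<otimes> g))
        = (\<Sum>k\<in>carrier G. y k * z (inv k \<otimes> (inv h \<otimes> g)))" if h: "h \<in> carrier G" for h
      using sum_translate[OF h, of "\<lambda>k. y (inv h \<otimes> k) * z (inv k \<otimes> g)"] h g
      by (simp add: m_assoc[symmetric] inv_mult_group)
    have "((x \<otimes>\<^bsub>A\<^esub> y) \<otimes>\<^bsub>A\<^esub> z) g
        = (\<Sum>k\<in>carrier G. \<Sum>h\<in>carrier G. x h * (y (inv h \<otimes> k) * z (inv k \<otimes> g)))"
      using g by (simp add: mult_A sum_distrib_right mult.assoc)
    also have "\<dots> = (\<Sum>h\<in>carrier G. x h * (\<Sum>k\<in>carrier G. y (inv h \<otimes> k) * z (inv k \<otimes> g)))"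
      by (subst sum.swap) (simp add: sum_distrib_left)
    also have "\<dots> = (x \<otimes>\<^bsub>A\<^esub> (y \<otimes>\<^bsub>A\<^esub> z)) g"
      using g by (simp add: mult_A inner)
    finally show ?thesis .
  qed (simp add: mult_A)
qed

lemma ring_A: "ring A"
proof (rule ringI)
  show "abelian_group A"
  proof (rule abelian_groupI)
    fix x assume "x \<in> carrier A"
    then show "\<exists>y\<in>carrier A. y \<oplus>\<^bsub>A\<^esub> x = \<zero>\<^bsub>A\<^esub>"
      by (intro bexI[of _ "\<lambda>g. - x g"]) (auto simp: A_defs)
  qed (auto simp: A_defs algebra_simps)
  show "Group.monoid A"
  proof (rule monoidI)
    fix x assume x: "x \<in> carrier A"
    have "x h * (if inv h \<otimes> g = \<one> then 1 else 0) = (if h = g then x g else 0)"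
      if "h \<in> carrier G" "g \<in> carrier G" for g h
      using that by (auto simp: inv_solve_left')
    then show "x \<otimes>\<^bsub>A\<^esub> \<one>\<^bsub>A\<^esub> = x"
      using x by (auto simp: A_defs sum.delta cong: sum.cong)
    have "(if h = \<one> then 1 else 0) * x (inv h \<otimes> g) = (if h = \<one> then x g else 0)"
      if "h \<in> carrier G" "g \<in> carrier G" for g h
      using that by auto
    then show "\<one>\<^bsub>A\<^esub> \<otimes>\<^bsub>A\<^esub> x = x"
      using x by (auto simp: A_defs sum.delta cong: sum.cong)
  next
    fix x y z show "x \<otimes>\<^bsub>A\<^esub> y \<otimes>\<^bsub>A\<^esub> z = x \<otimes>\<^bsub>A\<^esub> (y \<otimes>\<^bsub>A\<^esub> z)" by (rule A_assoc)
  qed (auto simp: A_defs)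
qed (auto simp: A_defs algebra_simps sum.distrib)

sublocale A: ring A by (rule ring_A)

lemma a_inv_A: "x \<in> carrier A \<Longrightarrow> \<ominus>\<^bsub>A\<^esub> x = (\<lambda>g. - x g)"
  by (rule A.minus_equality) (auto simp: A_defs)

lemma minus_A: "x \<in> carrier A \<Longrightarrow> y \<in> carrier A \<Longrightarrow> x \<ominus>\<^bsub>A\<^esub> y = (\<lambda>g. x g - y g)"
  by (auto simp: a_minus_def a_inv_A A_defs)

end

section \<open>Left cosets and restriction\<close>

locale coset_lumping = finite_group G for G (structure) +
  fixes H :: "'a set" and w :: "'a \<Rightarrow> real"
  assumes subgroup_H: "subgroup H G"
begin

abbreviation cosets :: "'a set set" where "cosets \<equiv> lcosets H"

lemma cosets_finite [simp]: "finite cosets"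
  by (simp add: LCOSETS_def)

lemma coset_of_in [simp]: "x \<in> carrier G \<Longrightarrow> x <# H \<in> cosets"
  by (auto simp: LCOSETS_def)

lemma coset_carrier: "b \<in> cosets \<Longrightarrow> x \<in> b \<Longrightarrow> x \<in> carrier G"
  using lcosets_part_G[OF subgroup_H] by blast

lemma coset_of_mem: "b \<in> cosets \<Longrightarrow> x \<in> b \<Longrightarrow> x <# H = b"
  using l_repr_independence[OF _ _ subgroup_H] by (auto simp: LCOSETS_def)

lemma mem_coset_iff:
  assumes "b \<in> cosets" "x \<in> carrier G"
  shows "x \<in> b \<longleftrightarrow> x <# H = b"
  using assms coset_of_mem lcos_self[OF _ subgroup_H] by blast

lemma coset_finite [simp]: "b \<in> cosets \<Longrightarrow> finite b"
  by (meson coset_carrier finite_carrier finite_subset subsetI)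

lemma card_coset: "b \<in> cosets \<Longrightarrow> card b = card H"
  using l_card_cosets_equal subgroup.subset[OF subgroup_H] finite_carrier by metis

lemma H_in_cosets: "H \<in> cosets"
  using coset_of_in[OF one_closed] lcos_mult_one[OF subgroup.subset[OF subgroup_H]] by simp

lemma card_H_pos: "0 < card H"
  using H_in_cosets coset_finite subgroup.one_closed[OF subgroup_H] card_gt_0_iff by blast

lemma mem_coset_of_iff:
  assumes "g \<in> carrier G" "k \<in> carrier G"
  shows "inv k \<otimes> g \<in> H \<longleftrightarrow> k \<in> g <# H"
proof -
  have "inv k \<otimes> g \<in> H \<longleftrightarrow> g \<in> k <# H"
    using assms subgroup_H is_group
    by (meson subgroup.lcos_module_imp subgroup.lcos_module_rev)
  also have "\<dots> \<longleftrightarrow> k \<in> g <# H"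
    using assms l_coset_swap subgroup_H by blast
  finally show ?thesis .
qed

lemma sum_cosets: "(\<Sum>b\<in>cosets. sum f b) = sum f (carrier G)"
  using sum.Union_disjoint[of cosets f] lcosets_part_G[OF subgroup_H] lcos_disjoint[OF subgroup_H]
  by simp

lemma sum_proj_cosets:
  assumes "x \<in> carrier A"
  shows "x g = (\<Sum>b\<in>cosets. proj b x g)"
proof (cases "g \<in> carrier G")
  case True
  have "(\<Sum>b\<in>cosets. proj b x g) = (\<Sum>b\<in>cosets. if b = g <# H then x g else 0)"
    by (rule sum.cong) (use True in \<open>auto simp: proj_def mem_coset_iff\<close>)
  then show ?thesis using True by simp
next
  case False
  then have "x g = 0" using assms by (simp add: carrier_A)
  then have "proj b x g = 0" for b by (simp add: proj_def)
  then show ?thesis using \<open>x g = 0\<close> by simp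
qed

lemma coset_translate:
  assumes "b \<in> cosets" "h \<in> carrier G"
  shows "h <# b \<in> cosets"
  using assms lcos_m_assoc[OF subgroup.subset[OF subgroup_H]] by (auto simp: LCOSETS_def)

lemma translate_mem_iff:
  assumes "b \<in> cosets" "h \<in> carrier G" "g \<in> carrier G"
  shows "inv h \<otimes> g \<in> inv h <# b \<longleftrightarrow> g \<in> b"
  using assms coset_carrier[OF assms(1)] by (auto simp: l_coset_def)

abbreviation w_hat where "w_hat \<equiv> real_elem G w"

lemma proj_closed [simp]: "x \<in> carrier A \<Longrightarrow> proj b x \<in> carrier A"
  by (auto simp: proj_def carrier_A)

lemma w_closed [simp]: "w_hat \<in> carrier A"
  by (auto simp: real_elem_def carrier_A)

lemma eta_coset_closed: "b \<in> cosets \<Longrightarrow> eta b \<in> carrier A"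
  using coset_carrier by (auto simp: eta_def carrier_A)

lemmas eta_H_closed [simp] = eta_coset_closed[OF H_in_cosets]

text \<open>
  The common mechanism by which left multiplication by \<open>r\<close> passes through right multiplication and
  restriction to cosets: \<open>x\<close> is the sum of the translates of vectors \<open>v h\<close>, weighted by \<open>r h\<close>, but the
  vectors may depend on \<open>h\<close>, because a restriction to \<open>b\<close> becomes one to the translate of \<open>b\<close> by
  the inverse of \<open>h\<close>.
\<close>

lemma mult_combination:
  assumes "\<And>k. k \<in> carrier G \<Longrightarrow> x k = (\<Sum>h\<in>carrier G. r h * v h (inv h \<otimes> k))"
    and g: "g \<in> carrier G"
  shows "(x \<otimes>\<^bsub>A\<^esub> y) g = (\<Sum>h\<in>carrier G. r h * (v h \<otimes>\<^bsub>A\<^esub> y) (inv h \<otimes> g))"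
proof -
  have "(x \<otimes>\<^bsub>A\<^esub> y) g
      = (\<Sum>k\<in>carrier G. \<Sum>h\<in>carrier G. r h * (v h (inv h \<otimes> k) * y (inv k \<otimes> g)))"
    using g assms(1) by (simp add: mult_A sum_distrib_right mult.assoc)
  also have "\<dots> = (\<Sum>h\<in>carrier G. r h * (\<Sum>k\<in>carrier G. v h (inv h \<otimes> k) * y (inv k \<otimes> g)))"
    by (subst sum.swap) (simp add: sum_distrib_left)
  also have "\<dots> = (\<Sum>h\<in>carrier G. r h * (v h \<otimes>\<^bsub>A\<^esub> y) (inv h \<otimes> g))"
  proof (rule sum.cong[OF refl])
    fix h assume h: "h \<in> carrier G"
    show "r h * (\<Sum>k\<in>carrier G. v h (inv h \<otimes> k) * y (inv k \<otimes> g))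
        = r h * (v h \<otimes>\<^bsub>A\<^esub> y) (inv h \<otimes> g)"
      using sum_translate[OF h, of "\<lambda>k. v h (inv h \<otimes> k) * y (inv k \<otimes> g)"] h g
      by (simp add: mult_A inv_mult_group m_assoc)
  qed
  finally show ?thesis .
qed

lemma mult_sum_left:
  "((\<lambda>k. \<Sum>i\<in>I. v i k) \<otimes>\<^bsub>A\<^esub> y) g = (\<Sum>i\<in>I. (v i \<otimes>\<^bsub>A\<^esub> y) g)"
  by (auto simp: mult_A sum_distrib_right intro: sum.swap)

section \<open>The lumping equation on a single coset\<close>

definition defect :: "'a \<Rightarrow> complex" where
  "defect = (\<one>\<^bsub>A\<^esub> \<ominus>\<^bsub>A\<^esub> eta H) \<otimes>\<^bsub>A\<^esub> w_hat \<otimes>\<^bsub>A\<^esub> eta H"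

lemma defect_closed [simp]: "defect \<in> carrier A"
  by (simp add: defect_def)

lemma mult_defect_split:
  assumes "x \<in> carrier A"
  shows "x \<otimes>\<^bsub>A\<^esub> defect
    = (x \<otimes>\<^bsub>A\<^esub> w_hat \<otimes>\<^bsub>A\<^esub> eta H) \<ominus>\<^bsub>A\<^esub> (x \<otimes>\<^bsub>A\<^esub> eta H \<otimes>\<^bsub>A\<^esub> w_hat \<otimes>\<^bsub>A\<^esub> eta H)"
proof -
  have "x \<otimes>\<^bsub>A\<^esub> defect = x \<otimes>\<^bsub>A\<^esub> (\<one>\<^bsub>A\<^esub> \<ominus>\<^bsub>A\<^esub> eta H) \<otimes>\<^bsub>A\<^esub> w_hat \<otimes>\<^bsub>A\<^esub> eta H"
    by (simp add: defect_def A_assoc)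
  also have "x \<otimes>\<^bsub>A\<^esub> (\<one>\<^bsub>A\<^esub> \<ominus>\<^bsub>A\<^esub> eta H) = x \<ominus>\<^bsub>A\<^esub> x \<otimes>\<^bsub>A\<^esub> eta H"
    using assms by (simp add: a_minus_def A.r_distr A.r_minus)
  finally show ?thesis
    using assms by (simp add: a_minus_def A.l_distr A.l_minus)
qed

lemma mult_eta_H:
  assumes g: "g \<in> carrier G"
  shows "(x \<otimes>\<^bsub>A\<^esub> eta H) g = (\<Sum>k\<in>g <# H. x k) / of_nat (card H)"
proof -
  have sub: "g <# H \<subseteq> carrier G" using coset_carrier[OF coset_of_in[OF g]] by blast
  have "(x \<otimes>\<^bsub>A\<^esub> eta H) g
      = (\<Sum>k\<in>carrier G. if k \<in> g <# H then x k / of_nat (card H) else 0)"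
    using g by (auto simp: mult_A eta_def mem_coset_of_iff intro!: sum.cong)
  also have "\<dots> = (\<Sum>k\<in>g <# H. x k / of_nat (card H))"
    using sub by (simp add: sum.inter_restrict[symmetric] Int_absorb1)
  finally show ?thesis by (simp add: sum_divide_distrib)
qed

text \<open>
  The total weight sent to \<open>c\<close> in one step by the uniform distribution on \<open>b\<close>; all cosets have
  cardinality \<open>card H\<close>.
\<close>

definition flow :: "'a set \<Rightarrow> 'a set \<Rightarrow> real" where
  "flow b c = (\<Sum>k\<in>b. \<Sum>y\<in>c. w (inv k \<otimes> y)) / card H"

text \<open>
  Multiplication by \<open>eta H\<close> averages over cosets. So the equation compares the masses that \<open>x w\<close> puts
  on the cosets with those of \<open>x' w\<close>, where \<open>x'\<close> is \<open>x\<close> made uniform on its coset; the latter depend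
  only on the total mass of \<open>x\<close>.
\<close>

lemma mult_defect_eq_zero_iff:
  assumes b: "b \<in> cosets" and x: "\<And>g. g \<notin> b \<Longrightarrow> x g = 0"
  shows "x \<otimes>\<^bsub>A\<^esub> defect = \<zero>\<^bsub>A\<^esub> \<longleftrightarrow>
    (\<forall>c\<in>cosets. (\<Sum>y\<in>c. (x \<otimes>\<^bsub>A\<^esub> w_hat) y) = (\<Sum>k\<in>b. x k) * of_real (flow b c))"
proof -
  have xA: "x \<in> carrier A" using x coset_carrier[OF b] by (auto simp: carrier_A)
  let ?s = "\<Sum>k\<in>b. x k"
  have xe: "(x \<otimes>\<^bsub>A\<^esub> eta H) g = (if g \<in> b then ?s / of_nat (card H) else 0)"
    if g: "g \<in> carrier G" for g
  proof (cases "g \<in> b")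
    case True
    then show ?thesis using g b by (simp add: mult_eta_H coset_of_mem)
  next
    case False
    have "(g <# H) \<inter> b = {}"
      using False lcos_disjoint[OF subgroup_H coset_of_in[OF g] b] mem_coset_iff[OF b g]
      by simp
    then have "(\<Sum>k\<in>g <# H. x k) = 0"
      using x by (intro sum.neutral) blast
    then show ?thesis using False g by (simp add: mult_eta_H)
  qed
  have xew: "(x \<otimes>\<^bsub>A\<^esub> eta H \<otimes>\<^bsub>A\<^esub> w_hat) y
      = ?s / of_nat (card H) * (\<Sum>k\<in>b. of_real (w (inv k \<otimes> y)))" if y: "y \<in> carrier G" for y
  proof -
    have "(x \<otimes>\<^bsub>A\<^esub> eta H \<otimes>\<^bsub>A\<^esub> w_hat) y
        = (\<Sum>k\<in>carrier G. (x \<otimes>\<^bsub>A\<^esub> eta H) k * w_hat (inv k \<otimes> y))"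
      using y by (simp add: mult_A[of "_ \<otimes>\<^bsub>A\<^esub> _"])
    also have "\<dots> = (\<Sum>k\<in>carrier G. if k \<in> b then ?s / of_nat (card H) * of_real (w (inv k \<otimes> y)) else 0)"
      using y by (intro sum.cong refl) (simp add: xe real_elem_def)
    also have "\<dots> = (\<Sum>k\<in>b. ?s / of_nat (card H) * of_real (w (inv k \<otimes> y)))"
      using coset_carrier[OF b] by (simp add: sum.inter_restrict[symmetric] Int_absorb1 subsetI)
    finally show ?thesis by (simp only: sum_distrib_left)
  qed
  have eq: "(x \<otimes>\<^bsub>A\<^esub> defect) g
      = ((\<Sum>y\<in>g <# H. (x \<otimes>\<^bsub>A\<^esub> w_hat) y) - ?s * of_real (flow b (g <# H))) / of_nat (card H)"
    if g: "g \<in> carrier G" for g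
  proof -
    have "(\<Sum>y\<in>g <# H. (x \<otimes>\<^bsub>A\<^esub> eta H \<otimes>\<^bsub>A\<^esub> w_hat) y)
        = (\<Sum>y\<in>g <# H. ?s / of_nat (card H) * (\<Sum>k\<in>b. of_real (w (inv k \<otimes> y))))"
      by (rule sum.cong[OF refl]) (use coset_carrier[OF coset_of_in[OF g]] xew in blast)
    also have "\<dots> = ?s / of_nat (card H) * (\<Sum>k\<in>b. \<Sum>y\<in>g <# H. of_real (w (inv k \<otimes> y)))"
      by (subst sum.swap) (simp only: sum_distrib_left)
    also have "\<dots> = ?s * of_real (flow b (g <# H))"
      by (simp add: flow_def)
    finally show ?thesis
      using g xA
      by (simp add: mult_defect_split minus_A mult_eta_H[OF g] diff_divide_distrib)
  qed
  show ?thesis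
  proof
    assume 0: "x \<otimes>\<^bsub>A\<^esub> defect = \<zero>\<^bsub>A\<^esub>"
    show "\<forall>c\<in>cosets. (\<Sum>y\<in>c. (x \<otimes>\<^bsub>A\<^esub> w_hat) y) = ?s * of_real (flow b c)"
    proof
      fix c assume "c \<in> cosets"
      then obtain g where g: "g \<in> carrier G" "c = g <# H" by (auto simp: LCOSETS_def)
      then show "(\<Sum>y\<in>c. (x \<otimes>\<^bsub>A\<^esub> w_hat) y) = ?s * of_real (flow b c)"
        using eq[of g] 0 card_H_pos by (simp add: zero_A)
    qed
  next
    assume "\<forall>c\<in>cosets. (\<Sum>y\<in>c. (x \<otimes>\<^bsub>A\<^esub> w_hat) y) = ?s * of_real (flow b c)"
    then have "(x \<otimes>\<^bsub>A\<^esub> defect) g = 0" for g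
      using eq[of g] by (cases "g \<in> carrier G") (auto simp: mult_A)
    then show "x \<otimes>\<^bsub>A\<^esub> defect = \<zero>\<^bsub>A\<^esub>" by (auto simp: zero_A)
  qed
qed

section \<open>Histories and the maximal ideal\<close>

primrec hist :: "('a \<Rightarrow> complex) \<Rightarrow> (nat \<Rightarrow> 'a set) \<Rightarrow> nat \<Rightarrow> 'a \<Rightarrow> complex" where
  "hist x b 0 = proj (b 0) x"
| "hist x b (Suc t) = proj (b (Suc t)) (hist x b t \<otimes>\<^bsub>A\<^esub> w_hat)"

text \<open>
  Quantifying over all coset sequences makes stability under \<open>w\<close> and under restriction immediate. The
  equation for \<open>x\<close> itself is recovered by adding up the histories of length zero.
\<close>

definition J :: "('a \<Rightarrow> complex) set" where
  "J = {x \<in> carrier A. \<forall>b t. (\<forall>i. b i \<in> cosets) \<longrightarrow> hist x b t \<otimes>\<^bsub>A\<^esub> defect = \<zero>\<^bsub>A\<^esub>}"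

lemma J_D: "x \<in> J \<Longrightarrow> (\<And>i. b i \<in> cosets) \<Longrightarrow> hist x b t \<otimes>\<^bsub>A\<^esub> defect = \<zero>\<^bsub>A\<^esub>"
  by (simp add: J_def)

lemma mult_in_A [simp]: "x \<otimes>\<^bsub>A\<^esub> y \<in> carrier A"
  by (simp add: carrier_A mult_A)

lemma hist_closed [simp]: "x \<in> carrier A \<Longrightarrow> hist x b t \<in> carrier A"
  by (cases t) simp_all

lemma hist_outside: "g \<notin> b t \<Longrightarrow> hist x b t g = 0"
  by (cases t) (simp_all add: proj_def)

lemma hist_add: "hist (x \<oplus>\<^bsub>A\<^esub> y) b t = hist x b t \<oplus>\<^bsub>A\<^esub> hist y b t"
  by (induction t) (auto simp: proj_def mult_A add_A algebra_simps sum.distrib)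

lemma hist_zero: "hist \<zero>\<^bsub>A\<^esub> b t = \<zero>\<^bsub>A\<^esub>"
  by (induction t) (auto simp: proj_def mult_A zero_A)

lemma hist_mult:
  assumes b: "\<And>i. b i \<in> cosets" and g: "g \<in> carrier G"
  shows "hist (r \<otimes>\<^bsub>A\<^esub> x) b t g
    = (\<Sum>h\<in>carrier G. r h * hist x (\<lambda>i. inv h <# b i) t (inv h \<otimes> g))"
  using g
proof (induction t arbitrary: g)
  case 0
  then show ?case
    using translate_mem_iff[OF b] by (auto simp: proj_def mult_A)
next
  case (Suc t)
  have "(hist (r \<otimes>\<^bsub>A\<^esub> x) b t \<otimes>\<^bsub>A\<^esub> w_hat) g
      = (\<Sum>h\<in>carrier G. r h * (hist x (\<lambda>i. inv h <# b i) t \<otimes>\<^bsub>A\<^esub> w_hat) (inv h \<otimes> g))"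
    using Suc by (intro mult_combination) auto
  then show ?case
    using translate_mem_iff[OF b _ Suc.prems] by (auto simp: proj_def)
qed

text \<open>
  The product with \<open>w\<close> has the histories of \<open>x\<close> preceded by one more, unspecified, coset.
\<close>

lemma hist_mult_weight:
  assumes x: "x \<in> carrier A"
  shows "hist (x \<otimes>\<^bsub>A\<^esub> w_hat) b t g = (\<Sum>c\<in>cosets. hist x (case_nat c b) (Suc t) g)"
proof (induction t arbitrary: g)
  case 0
  have "x = (\<lambda>k. \<Sum>c\<in>cosets. proj c x k)"
    using sum_proj_cosets[OF x] by blast
  then have "(x \<otimes>\<^bsub>A\<^esub> w_hat) g = (\<Sum>c\<in>cosets. (proj c x \<otimes>\<^bsub>A\<^esub> w_hat) g)"
    using mult_sum_left[of "\<lambda>c. proj c x" cosets w_hat g] by simp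
  then show ?case by (simp add: proj_def)
next
  case (Suc t)
  have "hist (x \<otimes>\<^bsub>A\<^esub> w_hat) b t = (\<lambda>k. \<Sum>c\<in>cosets. hist x (case_nat c b) (Suc t) k)"
    using Suc by blast
  then show ?case
    using mult_sum_left[of "\<lambda>c. hist x (case_nat c b) (Suc t)" cosets w_hat g]
    by (simp add: proj_def)
qed

lemma hist_proj_H:
  assumes "b 0 \<in> cosets"
  shows "hist (proj H x) b t = (if b 0 = H then hist x b t else \<zero>\<^bsub>A\<^esub>)"
proof (induction t)
  case 0
  have "proj (b 0) (proj H x) g = (if b 0 = H then proj (b 0) x g else 0)" for g
    using lcos_disjoint[OF subgroup_H assms H_in_cosets] by (auto simp: proj_def)
  then show ?case by (auto simp: zero_A fun_eq_iff)
qed (auto simp: proj_def mult_A zero_A)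

lemma J_mult_defect:
  assumes "x \<in> J"
  shows "x \<otimes>\<^bsub>A\<^esub> defect = \<zero>\<^bsub>A\<^esub>"
proof
  fix g
  have x: "x \<in> carrier A" using assms by (simp add: J_def)
  have "x = (\<lambda>k. \<Sum>c\<in>cosets. proj c x k)"
    using sum_proj_cosets[OF x] by blast
  then have "(x \<otimes>\<^bsub>A\<^esub> defect) g = (\<Sum>c\<in>cosets. (hist x (\<lambda>_. c) 0 \<otimes>\<^bsub>A\<^esub> defect) g)"
    using mult_sum_left[of "\<lambda>c. proj c x" cosets defect g] by simp
  also have "\<dots> = 0"
  proof (rule sum.neutral, rule ballI)
    fix c assume "c \<in> cosets"
    then have "hist x (\<lambda>_. c) 0 \<otimes>\<^bsub>A\<^esub> defect = \<zero>\<^bsub>A\<^esub>"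
      using assms J_D[of x "\<lambda>_. c" 0] by blast
    then show "(hist x (\<lambda>_. c) 0 \<otimes>\<^bsub>A\<^esub> defect) g = 0" by (simp add: zero_A)
  qed
  finally show "(x \<otimes>\<^bsub>A\<^esub> defect) g = \<zero>\<^bsub>A\<^esub> g" by (simp add: zero_A)
qed

lemma J_mult_left:
  assumes r: "r \<in> carrier A" and x: "x \<in> J"
  shows "r \<otimes>\<^bsub>A\<^esub> x \<in> J"
proof -
  have "(hist (r \<otimes>\<^bsub>A\<^esub> x) b t \<otimes>\<^bsub>A\<^esub> defect) g = 0"
    if b: "\<And>i. b i \<in> cosets" for b t g
  proof (cases "g \<in> carrier G")
    case g: True
    have "hist x (\<lambda>i. inv h <# b i) t \<otimes>\<^bsub>A\<^esub> defect = \<zero>\<^bsub>A\<^esub>" if "h \<in> carrier G" for h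
      using x that coset_translate[OF b] by (auto simp: J_def)
    then show ?thesis
      by (subst mult_combination[where r = r and v = "\<lambda>h. hist x (\<lambda>i. inv h <# b i) t"])
         (use hist_mult[of b] b g in \<open>simp_all add: zero_A\<close>)
  qed (simp add: mult_A)
  then show ?thesis using r x by (auto simp: J_def zero_A)
qed

lemma J_mult_weight:
  assumes x: "x \<in> J"
  shows "x \<otimes>\<^bsub>A\<^esub> w_hat \<in> J"
proof -
  have xA: "x \<in> carrier A" using x by (simp add: J_def)
  have "(hist (x \<otimes>\<^bsub>A\<^esub> w_hat) b t \<otimes>\<^bsub>A\<^esub> defect) g = 0"
    if b: "\<And>i. b i \<in> cosets" for b t g
  proof -
    have *: "hist x (case_nat c b) (Suc t) \<otimes>\<^bsub>A\<^esub> defect = \<zero>\<^bsub>A\<^esub>" if "c \<in> cosets" for c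
    proof -
      have "\<forall>i. case_nat c b i \<in> cosets"
        using that b by (auto split: nat.split)
      then show ?thesis using x J_D by blast
    qed
    have "hist (x \<otimes>\<^bsub>A\<^esub> w_hat) b t = (\<lambda>g. \<Sum>c\<in>cosets. hist x (case_nat c b) (Suc t) g)"
      using hist_mult_weight[OF xA] by blast
    then show ?thesis
      using * mult_sum_left[of "\<lambda>c. hist x (case_nat c b) (Suc t)" cosets defect g]
      by (simp add: zero_A)
  qed
  then show ?thesis using xA by (auto simp: J_def zero_A)
qed

lemma J_proj_H:
  assumes "x \<in> J"
  shows "proj H x \<in> J"
  using assms by (auto simp: J_def hist_proj_H)

lemma J_left_ideal: "left_ideal J A"
proof -
  have add: "x \<oplus>\<^bsub>A\<^esub> y \<in> J" if "x \<in> J" "y \<in> J" for x y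
    using that by (auto simp: J_def hist_add A.l_distr)
  have neg: "\<ominus>\<^bsub>A\<^esub> x \<in> J" if "x \<in> J" for x
  proof -
    have "x \<in> carrier A" using that by (simp add: J_def)
    then have "\<ominus>\<^bsub>A\<^esub> x = (\<ominus>\<^bsub>A\<^esub> \<one>\<^bsub>A\<^esub>) \<otimes>\<^bsub>A\<^esub> x" by (simp add: A.l_minus)
    then show ?thesis using J_mult_left[OF _ that] by simp
  qed
  have zero: "\<zero>\<^bsub>A\<^esub> \<in> J" by (simp add: J_def hist_zero)
  have "subgroup J (add_monoid A)"
    by (rule A.add.subgroupI) (use add neg zero in \<open>auto simp: a_inv_def[symmetric] J_def\<close>)
  then show ?thesis
    by (simp add: left_ideal_def additive_subgroupI J_mult_left)
qed

lemma lumping_GL_ideal_iff: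
  "lumping_GL_ideal G H w L \<longleftrightarrow> GL_ideal G H w L \<and> (\<forall>x\<in>L. x \<otimes>\<^bsub>A\<^esub> defect = \<zero>\<^bsub>A\<^esub>)"
  by (simp add: lumping_GL_ideal_def defect_def A_assoc)

text \<open>
  Restriction to \<open>a H\<close> is restriction to \<open>H\<close> conjugated by left multiplication by \<open>a\<close>.
\<close>

lemma left_ideal_proj_coset:
  assumes L: "left_ideal L A" and proj: "proj H ` L \<subseteq> L" and b: "b \<in> cosets" and x: "x \<in> L"
  shows "proj b x \<in> L"
proof -
  \<comment> \<open>The group element \<open>a\<close> as an element of the group algebra.\<close>
  let ?\<delta> = "\<lambda>a g. if g = a then 1 else (0::complex)"
  have \<delta>: "(?\<delta> a \<otimes>\<^bsub>A\<^esub> y) g = (if g \<in> carrier G then y (inv a \<otimes> g) else 0)"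
    if "a \<in> carrier G" for a y g
  proof -
    have "(\<Sum>h\<in>carrier G. ?\<delta> a h * y (inv h \<otimes> g))
        = (\<Sum>h\<in>carrier G. if h = a then y (inv a \<otimes> g) else 0)"
      by (intro sum.cong) auto
    then show ?thesis using that by (simp add: mult_A)
  qed
  obtain a where a: "a \<in> carrier G" "b = a <# H" using b by (auto simp: LCOSETS_def)
  have \<delta>_closed: "?\<delta> a \<in> carrier A" if "a \<in> carrier G" for a
    using that by (auto simp: carrier_A)
  have mult: "r \<otimes>\<^bsub>A\<^esub> y \<in> L" if "r \<in> carrier A" "y \<in> L" for r y
    using L that by (simp add: left_ideal_def)
  have "?\<delta> (inv a) \<otimes>\<^bsub>A\<^esub> x \<in> L"
    using \<delta>_closed a(1) x by (intro mult) simp_all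
  then have "?\<delta> a \<otimes>\<^bsub>A\<^esub> proj H (?\<delta> (inv a) \<otimes>\<^bsub>A\<^esub> x) \<in> L"
    using proj \<delta>_closed a(1) by (intro mult) blast+
  also have "?\<delta> a \<otimes>\<^bsub>A\<^esub> proj H (?\<delta> (inv a) \<otimes>\<^bsub>A\<^esub> x) = proj b x"
  proof
    fix g
    have "inv a \<otimes> g \<in> H \<longleftrightarrow> g \<in> b" if "g \<in> carrier G"
      using mem_coset_of_iff[OF that a(1)] l_coset_swap[OF _ _ subgroup_H] that a by blast
    moreover have "g \<notin> carrier G \<Longrightarrow> g \<notin> b" using coset_carrier[OF b] by blast
    ultimately show "(?\<delta> a \<otimes>\<^bsub>A\<^esub> proj H (?\<delta> (inv a) \<otimes>\<^bsub>A\<^esub> x)) g = proj b x g"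
      using a(1) by (auto simp: \<delta> proj_def)
  qed
  finally show ?thesis .
qed

lemma lumping_GL_ideal_subset_J:
  assumes "lumping_GL_ideal G H w L"
  shows "L \<subseteq> J"
proof
  fix x assume x: "x \<in> L"
  have L: "left_ideal L A" "proj H ` L \<subseteq> L" "\<And>y. y \<in> L \<Longrightarrow> y \<otimes>\<^bsub>A\<^esub> w_hat \<in> L"
    and 0: "\<And>y. y \<in> L \<Longrightarrow> y \<otimes>\<^bsub>A\<^esub> defect = \<zero>\<^bsub>A\<^esub>"
    using assms by (auto simp: lumping_GL_ideal_iff GL_ideal_def)
  have "hist x b t \<in> L" if "\<And>i. b i \<in> cosets" for b t
    by (induction t) (use x that L left_ideal_proj_coset[OF L(1,2)] in auto)
  moreover have "x \<in> carrier A"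
    using x L(1) additive_subgroup.a_subset by (auto simp: left_ideal_def)
  ultimately show "x \<in> J" using 0 by (auto simp: J_def)
qed

lemma J_ideal_eq:
  assumes "eta (carrier G) \<in> J"
  shows "J_ideal G H w = J"
proof -
  have "lumping_GL_ideal G H w J"
    using assms J_left_ideal J_mult_weight J_proj_H J_mult_defect
    by (auto simp: lumping_GL_ideal_iff GL_ideal_def)
  then show ?thesis
    unfolding J_ideal_def using lumping_GL_ideal_subset_J
    by (intro the_equality) (blast, meson subset_antisym)
qed

text \<open>
  The sum of all group elements absorbs any \<open>x\<close> on its right up to the factor \<open>\<Sum>g. x g\<close>, which makes
  membership of the uniform vector a matter of exhibiting one normalised element.
\<close>

lemma eta_carrier_in_J:
  assumes "x \<in> J" "(\<Sum>g\<in>carrier G. x g) = 1"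
  shows "eta (carrier G) \<in> J"
proof -
  have "eta (carrier G) \<otimes>\<^bsub>A\<^esub> x = eta (carrier G)"
  proof
    fix g
    have "(\<Sum>h\<in>carrier G. eta (carrier G) h * x (inv h \<otimes> g)) = 1 / of_nat (card (carrier G))"
      if "g \<in> carrier G"
      using sum_inverse_translate[OF that, of x] assms(2)
      by (simp add: eta_def sum_divide_distrib[symmetric])
    then show "(eta (carrier G) \<otimes>\<^bsub>A\<^esub> x) g = eta (carrier G) g"
      by (simp add: mult_A) (simp add: eta_def)
  qed
  moreover have "eta (carrier G) \<in> carrier A" by (simp add: eta_def carrier_A)
  ultimately show ?thesis using J_mult_left[OF _ assms(1)] by metis
qed

end


section \<open>Finite Markov chains\<close>

lemma (in prob_space) prob_split:
  assumes "finite I" "\<And>\<omega>. \<omega> \<in> space M \<Longrightarrow> R \<omega> \<Longrightarrow> Z \<omega> \<in> I"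
    and "\<And>i. i \<in> I \<Longrightarrow> {\<omega> \<in> space M. R \<omega> \<and> Z \<omega> = i} \<in> events"
  shows "\<P>(\<omega> in M. R \<omega>) = (\<Sum>i\<in>I. \<P>(\<omega> in M. R \<omega> \<and> Z \<omega> = i))"
proof -
  have "{\<omega> \<in> space M. R \<omega>} = (\<Union>i\<in>I. {\<omega> \<in> space M. R \<omega> \<and> Z \<omega> = i})"
    using assms(2) by auto
  then show ?thesis
    using finite_measure_finite_Union[of I "\<lambda>i. {\<omega> \<in> space M. R \<omega> \<and> Z \<omega> = i}"] assms
    by (auto simp: disjoint_family_on_def)
qed

lemma markov_chain_event:
  assumes "markov_chain M S Y P"
  shows "{\<omega> \<in> space M. Y i \<omega> \<in> B} \<in> sets M"
proof -
  have Y: "Y i \<in> M \<rightarrow>\<^sub>M count_space S" using assms by (simp add: markov_chain_def)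
  have "{\<omega> \<in> space M. Y i \<omega> \<in> B} = Y i -` (B \<inter> S) \<inter> space M"
    using measurable_space[OF Y] by auto
  then show ?thesis using measurable_sets[OF Y, of "B \<inter> S"] by simp
qed

lemma markov_chain_state:
  "markov_chain M S Y P \<Longrightarrow> \<omega> \<in> space M \<Longrightarrow> Y i \<omega> \<in> S"
  using measurable_space[of "Y i" M "count_space S"] by (auto simp: markov_chain_def)

lemma markov_chain_pred:
  assumes "markov_chain M S Y P"
  shows "Measurable.pred M (\<lambda>\<omega>. Y i \<omega> \<in> B)" "Measurable.pred M (\<lambda>\<omega>. Y i \<omega> = x)"
  using markov_chain_event[OF assms, of i B] markov_chain_event[OF assms, of i "{x}"]
  by (simp_all add: pred_def)

text \<open>
  The product form of the Markov property, valid also for paths of probability zero: then both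
  sides vanish, whatever the value of \<open>P\<close>.
\<close>

lemma markov_chain_path_step:
  assumes mc: "markov_chain M S Y P" and y: "\<And>i. i \<le> Suc t \<Longrightarrow> y i \<in> S"
  shows "\<P>(\<omega> in M. \<forall>i\<le>Suc t. Y i \<omega> = y i)
    = \<P>(\<omega> in M. \<forall>i\<le>t. Y i \<omega> = y i) * P (y t) (y (Suc t))"
proof -
  interpret prob_space M using mc by (simp add: markov_chain_def)
  note [measurable] = markov_chain_pred[OF mc]
  let ?h = "\<P>(\<omega> in M. \<forall>i\<le>t. Y i \<omega> = y i)"
  have split: "(\<forall>i\<le>Suc t. Y i \<omega> = y i)
      \<longleftrightarrow> Y (Suc t) \<omega> = y (Suc t) \<and> (\<forall>i\<le>t. Y i \<omega> = y i)" for \<omega>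
    by (auto simp: le_Suc_eq)
  show ?thesis
  proof (cases "?h > 0")
    case True
    then have "\<P>(\<omega> in M. Y (Suc t) \<omega> = y (Suc t) \<bar> \<forall>i\<le>t. Y i \<omega> = y i) = P (y t) (y (Suc t))"
      using mc y unfolding markov_chain_def by blast
    then show ?thesis using True by (simp add: cond_prob_def split field_simps)
  next
    case False
    then have "?h = 0" by (simp add: not_less measure_le_0_iff)
    moreover have "\<P>(\<omega> in M. \<forall>i\<le>Suc t. Y i \<omega> = y i) \<le> ?h"
      by (rule finite_measure_mono) auto
    ultimately show ?thesis by (simp add: measure_le_0_iff)
  qed
qed

text \<open>
  The Markov property is given for histories that fix every state. Conditioning on coarser events, such
  as a history of cosets, is still possible as long as the present state is fixed, by summing over the
  finitely many paths in the event.
\<close>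

lemma markov_chain_step:
  assumes mc: "markov_chain M S Y P" and x: "x \<in> S" and y: "y \<in> S"
  shows "\<P>(\<omega> in M. ((\<forall>i\<le>t. Y i \<omega> \<in> B i) \<and> Y t \<omega> = x) \<and> Y (Suc t) \<omega> = y)
    = \<P>(\<omega> in M. (\<forall>i\<le>t. Y i \<omega> \<in> B i) \<and> Y t \<omega> = x) * P x y"
proof -
  interpret prob_space M using mc by (simp add: markov_chain_def)
  note [measurable] = markov_chain_pred[OF mc]
  define F where "F = (\<Pi>\<^sub>E i\<in>{..t}. {z \<in> S. z \<in> B i \<and> (i = t \<longrightarrow> z = x)})"
  define Z where "Z = (\<lambda>\<omega>. restrict (\<lambda>i. Y i \<omega>) {..t})"
  let ?R = "\<lambda>\<omega>. (\<forall>i\<le>t. Y i \<omega> \<in> B i) \<and> Y t \<omega> = x"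
  have "finite S" using mc by (simp add: markov_chain_def)
  then have fin: "finite F" by (auto simp: F_def intro!: finite_PiE)
  have ZF: "Z \<omega> \<in> F" if "\<omega> \<in> space M" "?R \<omega>" for \<omega>
    using that markov_chain_state[OF mc that(1)] by (auto simp: Z_def F_def)
  have path: "?R \<omega> \<and> Z \<omega> = f \<longleftrightarrow> (\<forall>i\<le>t. Y i \<omega> = f i)" if f: "f \<in> F" for f \<omega>
  proof
    assume *: "\<forall>i\<le>t. Y i \<omega> = f i"
    have "Z \<omega> i = f i" for i
      using * PiE_arb[OF f[unfolded F_def], of i] by (cases "i \<le> t") (simp_all add: Z_def)
    then have "Z \<omega> = f" by blast
    moreover have "?R \<omega>" using * f by (auto simp: F_def PiE_iff)
    ultimately show "?R \<omega> \<and> Z \<omega> = f" by blast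
  qed (auto simp: Z_def)
  have "\<P>(\<omega> in M. ?R \<omega> \<and> Y (Suc t) \<omega> = y)
      = (\<Sum>f\<in>F. \<P>(\<omega> in M. (?R \<omega> \<and> Y (Suc t) \<omega> = y) \<and> Z \<omega> = f))"
  proof (rule prob_split[OF fin])
    fix f assume f: "f \<in> F"
    have "{\<omega> \<in> space M. (?R \<omega> \<and> Y (Suc t) \<omega> = y) \<and> Z \<omega> = f}
        = {\<omega> \<in> space M. (\<forall>i\<le>t. Y i \<omega> = f i) \<and> Y (Suc t) \<omega> = y}"
      using path[OF f] by blast
    then show "{\<omega> \<in> space M. (?R \<omega> \<and> Y (Suc t) \<omega> = y) \<and> Z \<omega> = f} \<in> events" by simp
  qed (use ZF in blast)
  also have "\<dots> = (\<Sum>f\<in>F. \<P>(\<omega> in M. ?R \<omega> \<and> Z \<omega> = f) * P x y)"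
  proof (rule sum.cong[OF refl])
    fix f assume f: "f \<in> F"
    let ?f = "f(Suc t := y)"
    have "\<P>(\<omega> in M. (?R \<omega> \<and> Y (Suc t) \<omega> = y) \<and> Z \<omega> = f)
        = \<P>(\<omega> in M. \<forall>i\<le>Suc t. Y i \<omega> = ?f i)"
      using path[OF f] by (intro arg_cong[where f = prob] Collect_cong) (auto simp: le_Suc_eq)
    also have "\<dots> = \<P>(\<omega> in M. \<forall>i\<le>t. Y i \<omega> = ?f i) * P (?f t) (?f (Suc t))"
      by (rule markov_chain_path_step[OF mc]) (use f y in \<open>auto simp: F_def PiE_iff le_Suc_eq\<close>)
    also have "\<P>(\<omega> in M. \<forall>i\<le>t. Y i \<omega> = ?f i) = \<P>(\<omega> in M. ?R \<omega> \<and> Z \<omega> = f)"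
      using path[OF f] by (intro arg_cong[where f = prob] Collect_cong) auto
    also have "?f t = x" using f by (auto simp: F_def PiE_iff)
    finally show "\<P>(\<omega> in M. (?R \<omega> \<and> Y (Suc t) \<omega> = y) \<and> Z \<omega> = f)
        = \<P>(\<omega> in M. ?R \<omega> \<and> Z \<omega> = f) * P x y" by simp
  qed
  also have "\<dots> = \<P>(\<omega> in M. ?R \<omega>) * P x y"
  proof -
    have "\<P>(\<omega> in M. ?R \<omega>) = (\<Sum>f\<in>F. \<P>(\<omega> in M. ?R \<omega> \<and> Z \<omega> = f))"
    proof (rule prob_split[OF fin])
      fix f assume f: "f \<in> F"
      have "{\<omega> \<in> space M. ?R \<omega> \<and> Z \<omega> = f} = {\<omega> \<in> space M. \<forall>i\<le>t. Y i \<omega> = f i}"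
        using path[OF f] by blast
      then show "{\<omega> \<in> space M. ?R \<omega> \<and> Z \<omega> = f} \<in> events" by simp
    qed (use ZF in blast)
    then show ?thesis by (simp add: sum_distrib_right)
  qed
  finally show ?thesis .
qed

section \<open>Convergence of time averages to the uniform law\<close>

context finite_group begin

text \<open>
  Translations and inversion permute \<open>G\<close>, so both the rows and the columns of the matrix with entries
  \<open>p (inv x \<otimes> y)\<close> sum to one; expanding the square therefore leaves twice the inner product of \<open>f\<close>
  with the amount by which it fails to be invariant.
\<close>

lemma dirichlet_form:
  fixes f p :: "'a \<Rightarrow> real"
  assumes p: "(\<Sum>g\<in>carrier G. p g) = 1"
  shows "(\<Sum>x\<in>carrier G. \<Sum>y\<in>carrier G. p (inv x \<otimes> y) * (f y - f x)\<^sup>2)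
    = 2 * (\<Sum>y\<in>carrier G. f y * (f y - (\<Sum>x\<in>carrier G. f x * p (inv x \<otimes> y))))"
proof -
  have row: "(\<Sum>y\<in>carrier G. p (inv x \<otimes> y)) = 1" if "x \<in> carrier G" for x
    using sum_translate[of "inv x" p] that p by simp
  have col: "(\<Sum>x\<in>carrier G. p (inv x \<otimes> y)) = 1" if "y \<in> carrier G" for y
    using sum_inverse_translate[OF that, of p] p by simp
  have "(\<Sum>x\<in>carrier G. \<Sum>y\<in>carrier G. p (inv x \<otimes> y) * (f y - f x)\<^sup>2)
      = (\<Sum>x\<in>carrier G. \<Sum>y\<in>carrier G. (f y)\<^sup>2 * p (inv x \<otimes> y))
        + (\<Sum>x\<in>carrier G. \<Sum>y\<in>carrier G. (f x)\<^sup>2 * p (inv x \<otimes> y))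
        - 2 * (\<Sum>x\<in>carrier G. \<Sum>y\<in>carrier G. f y * (f x * p (inv x \<otimes> y)))"
    by (simp add: sum.distrib[symmetric] sum_subtractf[symmetric] sum_distrib_left
        power2_eq_square algebra_simps)
  also have "(\<Sum>x\<in>carrier G. \<Sum>y\<in>carrier G. (f y)\<^sup>2 * p (inv x \<otimes> y)) = (\<Sum>y\<in>carrier G. (f y)\<^sup>2)"
    by (subst sum.swap) (simp add: sum_distrib_left[symmetric] col)
  also have "(\<Sum>x\<in>carrier G. \<Sum>y\<in>carrier G. (f x)\<^sup>2 * p (inv x \<otimes> y)) = (\<Sum>y\<in>carrier G. (f y)\<^sup>2)"
    by (simp add: sum_distrib_left[symmetric] row)
  also have "(\<Sum>x\<in>carrier G. \<Sum>y\<in>carrier G. f y * (f x * p (inv x \<otimes> y)))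
      = (\<Sum>y\<in>carrier G. f y * (\<Sum>x\<in>carrier G. f x * p (inv x \<otimes> y)))"
    by (subst sum.swap) (simp add: sum_distrib_left)
  finally show ?thesis
    by (simp add: sum_subtractf power2_eq_square algebra_simps sum_distrib_left)
qed

text \<open>
  The average \<open>f n\<close> of the first \<open>n\<close> laws is invariant up to an error of order \<open>1 / n\<close>, by telescoping.
  Inserted into the Dirichlet form, this bounds the squared increments of \<open>f n\<close> along every
  \<open>s\<close> in the support of \<open>p\<close> by a multiple of \<open>1 / n\<close>. The group elements along which the increments
  vanish in the limit form a subgroup, so they are all of \<open>G\<close>, and \<open>f n\<close> becomes constant. Averages
  are used because the laws themselves need not converge when the chain is periodic.
\<close>

lemma cesaro_uniform:
  fixes p :: "'a \<Rightarrow> real" and \<mu> :: "nat \<Rightarrow> 'a \<Rightarrow> real"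
  assumes p_nonneg: "\<And>g. g \<in> carrier G \<Longrightarrow> 0 \<le> p g" and p_sum: "(\<Sum>g\<in>carrier G. p g) = 1"
    and gen: "generate G {g \<in> carrier G. p g \<noteq> 0} = carrier G"
    and \<mu>_nonneg: "\<And>t g. g \<in> carrier G \<Longrightarrow> 0 \<le> \<mu> t g"
    and \<mu>_sum: "\<And>t. (\<Sum>g\<in>carrier G. \<mu> t g) = 1"
    and \<mu>_step: "\<And>t y. y \<in> carrier G \<Longrightarrow> \<mu> (Suc t) y = (\<Sum>x\<in>carrier G. \<mu> t x * p (inv x \<otimes> y))"
    and g: "g \<in> carrier G"
  shows "(\<lambda>n. (\<Sum>t<n. \<mu> t g) / n) \<longlonglongrightarrow> 1 / card (carrier G)"
proof -
  define f where "f = (\<lambda>n g. (\<Sum>t<n. \<mu> t g) / real n)"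
  have \<mu>_le: "\<mu> t g \<le> 1" if "g \<in> carrier G" for t g
    using member_le_sum[of g "carrier G" "\<mu> t"] that \<mu>_nonneg \<mu>_sum by auto
  have f_nonneg: "0 \<le> f n g" if "g \<in> carrier G" for n g
    using that by (simp add: f_def sum_nonneg \<mu>_nonneg)
  have f_sum: "(\<Sum>g\<in>carrier G. f n g) = 1" if "n > 0" for n
    using that \<mu>_sum
    by (simp add: f_def sum_divide_distrib[symmetric]) (subst sum.swap, simp)
  have f_step: "f n y - (\<Sum>x\<in>carrier G. f n x * p (inv x \<otimes> y)) = (\<mu> 0 y - \<mu> n y) / n"
    if y: "y \<in> carrier G" for n y
  proof -
    have "(\<Sum>x\<in>carrier G. f n x * p (inv x \<otimes> y))
        = (\<Sum>x\<in>carrier G. \<Sum>t<n. \<mu> t x * p (inv x \<otimes> y)) / n"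
      by (simp add: f_def sum_distrib_right sum_divide_distrib)
    also have "\<dots> = (\<Sum>t<n. \<mu> (Suc t) y) / n"
      by (subst sum.swap) (simp add: \<mu>_step[OF y])
    finally show ?thesis
      using sum_lessThan_telescope'[of "\<lambda>t. \<mu> t y" n]
      by (simp add: f_def diff_divide_distrib[symmetric] sum_subtractf[symmetric])
  qed
  have square_bound: "p s * (f n (x \<otimes> s) - f n x)\<^sup>2 \<le> 2 / n"
    if n: "n > 0" and x: "x \<in> carrier G" and s: "s \<in> carrier G" for n x s
  proof -
    let ?D = "\<lambda>x y. p (inv x \<otimes> y) * (f n y - f n x)\<^sup>2"
    have nn: "0 \<le> ?D x y" if "x \<in> carrier G" "y \<in> carrier G" for x y
      using that p_nonneg by simp
    have "p s * (f n (x \<otimes> s) - f n x)\<^sup>2 = ?D x (x \<otimes> s)" using x s by simp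
    also have "\<dots> \<le> (\<Sum>y\<in>carrier G. ?D x y)"
      by (rule member_le_sum) (use nn x s in auto)
    also have "\<dots> \<le> (\<Sum>x\<in>carrier G. \<Sum>y\<in>carrier G. ?D x y)"
      by (rule member_le_sum[where f = "\<lambda>x. \<Sum>y\<in>carrier G. ?D x y"])
         (use nn x in \<open>auto intro!: sum_nonneg\<close>)
    also have "\<dots> = 2 * (\<Sum>y\<in>carrier G. f n y * ((\<mu> 0 y - \<mu> n y) / n))"
      unfolding dirichlet_form[OF p_sum] by (simp add: f_step)
    also have "\<dots> \<le> 2 * (\<Sum>y\<in>carrier G. f n y * (1 / n))"
    proof (intro mult_left_mono sum_mono)
      fix y assume y: "y \<in> carrier G"
      have "\<mu> 0 y - \<mu> n y \<le> 1" using \<mu>_le[OF y, of 0] \<mu>_nonneg[OF y, of n] by linarith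
      then show "(\<mu> 0 y - \<mu> n y) / n \<le> 1 / n" by (simp add: divide_right_mono)
    qed (use f_nonneg in auto)
    also have "\<dots> = 2 / n"
      using f_sum[OF n] by (simp add: sum_divide_distrib[symmetric])
    finally show ?thesis .
  qed
  have step_lim: "(\<lambda>n. f n (x \<otimes> s) - f n x) \<longlonglongrightarrow> 0"
    if x: "x \<in> carrier G" and s: "s \<in> carrier G" "p s \<noteq> 0" for x s
  proof -
    have ps: "p s > 0" using p_nonneg[OF s(1)] s(2) by simp
    have "(\<lambda>n. (f n (x \<otimes> s) - f n x)\<^sup>2) \<longlonglongrightarrow> 0"
    proof (rule tendsto_sandwich[of "\<lambda>_. 0"])
      show "\<forall>\<^sub>F n in sequentially. (f n (x \<otimes> s) - f n x)\<^sup>2 \<le> 2 / p s / real n"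
        using eventually_gt_at_top[of 0]
      proof eventually_elim
        case (elim n)
        then show ?case using square_bound[OF elim x s(1)] ps by (simp add: field_simps)
      qed
      show "(\<lambda>n. 2 / p s / real n) \<longlonglongrightarrow> 0" by (rule lim_const_over_n)
    qed auto
    from tendsto_real_sqrt[OF this] show ?thesis
      by (simp add: tendsto_rabs_zero_iff)
  qed
  have lim: "\<forall>x\<in>carrier G. (\<lambda>n. f n (x \<otimes> s) - f n x) \<longlonglongrightarrow> 0" if "s \<in> carrier G" for s
  proof -
    have "s \<in> generate G {g \<in> carrier G. p g \<noteq> 0}" using that gen by simp
    then show ?thesis
    proof (induction rule: generate.induct)
      case (inv s)
      then have s: "s \<in> carrier G" "p s \<noteq> 0" by auto
      show ?case
      proof
        fix x assume x: "x \<in> carrier G"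
        have "(\<lambda>n. - (f n ((x \<otimes> inv s) \<otimes> s) - f n (x \<otimes> inv s))) \<longlonglongrightarrow> 0"
          using tendsto_minus[OF step_lim[of "x \<otimes> inv s" s]] x s by simp
        then show "(\<lambda>n. f n (x \<otimes> inv s) - f n x) \<longlonglongrightarrow> 0" using x s by (simp add: m_assoc)
      qed
    next
      case (eng s s')
      have s: "s \<in> carrier G" "s' \<in> carrier G" using eng(1,2) gen by auto
      show ?case
      proof
        fix x assume x: "x \<in> carrier G"
        have "(\<lambda>n. (f n (x \<otimes> s \<otimes> s') - f n (x \<otimes> s)) + (f n (x \<otimes> s) - f n x)) \<longlonglongrightarrow> 0 + 0"
          using eng.IH x s by (intro tendsto_add) auto
        then show "(\<lambda>n. f n (x \<otimes> (s \<otimes> s')) - f n x) \<longlonglongrightarrow> 0" using x s by (simp add: m_assoc)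
      qed
    qed (use step_lim in auto)
  qed
  \<comment> \<open>As \<open>f n\<close> has total mass one, its increments from \<open>g\<close> to all elements of \<open>G\<close> determine \<open>f n g\<close>.\<close>
  let ?N = "real (card (carrier G))"
  have N: "?N > 0" using one_closed finite_carrier by (auto simp: card_gt_0_iff simp del: one_closed)
  have "(\<lambda>n. (1 - (\<Sum>s\<in>carrier G. f n (g \<otimes> s) - f n g)) / ?N) \<longlonglongrightarrow> (1 - (\<Sum>s\<in>carrier G. 0)) / ?N"
    using lim g N by (intro tendsto_intros) auto
  moreover have "\<forall>\<^sub>F n in sequentially. (1 - (\<Sum>s\<in>carrier G. f n (g \<otimes> s) - f n g)) / ?N = f n g"
    using eventually_gt_at_top[of 0]
  proof eventually_elim
    case (elim n)
    have "(\<Sum>s\<in>carrier G. f n (g \<otimes> s) - f n g) = 1 - ?N * f n g"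
      using sum_translate[OF g, of "f n"] f_sum[OF elim] by (simp add: sum_subtractf)
    then show ?case using g by auto
  qed
  ultimately have "(\<lambda>n. f n g) \<longlonglongrightarrow> (1 - (\<Sum>s\<in>carrier G. 0)) / ?N"
    by (rule Lim_transform_eventually)
  then show ?thesis by (simp add: f_def)
qed

end


section \<open>Weak lumping as membership in the ideal\<close>

locale weighted_lumping = coset_lumping +
  assumes weight_w: "weight G w"
begin

definition total :: real where "total = (\<Sum>g\<in>carrier G. w g)"

definition incr :: "'a \<Rightarrow> real" where "incr g = w g / total"

lemma w_nonneg: "g \<in> carrier G \<Longrightarrow> 0 \<le> w g"
  using weight_w by (simp add: weight_def)

lemma total_pos: "0 < total"
proof -
  obtain g where "g \<in> carrier G" "0 < w g"
    using weight_w by (force simp: weight_def)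
  then show ?thesis
    unfolding total_def using w_nonneg by (intro sum_pos2) auto
qed

lemma incr_nonneg: "g \<in> carrier G \<Longrightarrow> 0 \<le> incr g"
  using w_nonneg total_pos by (simp add: incr_def)

lemma incr_sum: "(\<Sum>g\<in>carrier G. incr g) = 1"
  using total_pos by (simp add: incr_def sum_divide_distrib[symmetric] total_def[symmetric])

lemma is_MC_iff:
  "is_MC G \<alpha> w M X \<longleftrightarrow> markov_chain M (carrier G) X (\<lambda>x y. incr (inv x \<otimes> y)) \<and>
     (\<forall>x\<in>carrier G. \<P>(\<omega> in M. X 0 \<omega> = x) = pmf \<alpha> x)"
  by (simp add: is_MC_def incr_def total_def)

text \<open>
  The transition probabilities between cosets of a chain whose current state is uniform on its coset.
\<close>

definition Q_unif :: "'a set \<Rightarrow> 'a set \<Rightarrow> real" where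
  "Q_unif b c = flow b c / total"

lemma Q_unif_eq: "Q_unif b c = (\<Sum>k\<in>b. \<Sum>y\<in>c. incr (inv k \<otimes> y)) / card H"
  by (simp add: Q_unif_def flow_def incr_def sum_divide_distrib[symmetric])

lemma Q_unif_nonneg: "b \<in> cosets \<Longrightarrow> c \<in> cosets \<Longrightarrow> 0 \<le> Q_unif b c"
  unfolding Q_unif_eq using coset_carrier by (auto intro!: divide_nonneg_nonneg sum_nonneg incr_nonneg)

lemma Q_unif_sum:
  assumes b: "b \<in> cosets"
  shows "(\<Sum>c\<in>cosets. Q_unif b c) = 1"
proof -
  have "(\<Sum>y\<in>carrier G. incr (inv k \<otimes> y)) = 1" if "k \<in> b" for k
    using sum_translate[of "inv k" incr] incr_sum coset_carrier[OF b that] by simp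
  moreover have "(\<Sum>c\<in>cosets. Q_unif b c)
      = (\<Sum>k\<in>b. \<Sum>c\<in>cosets. \<Sum>y\<in>c. incr (inv k \<otimes> y)) / card H"
    unfolding Q_unif_eq sum_divide_distrib[symmetric] by (subst sum.swap) simp
  ultimately show ?thesis
    using card_H_pos card_coset[OF b] by (simp add: sum_cosets)
qed

lemma hist_mult_defect_iff:
  assumes "b t \<in> cosets"
  shows "hist x b t \<otimes>\<^bsub>A\<^esub> defect = \<zero>\<^bsub>A\<^esub> \<longleftrightarrow>
    (\<forall>c\<in>cosets. (\<Sum>y\<in>c. (hist x b t \<otimes>\<^bsub>A\<^esub> w_hat) y)
      = (\<Sum>k\<in>b t. hist x b t k) * of_real (flow (b t) c))"
  using assms hist_outside by (rule mult_defect_eq_zero_iff)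

lemma hist_cong: "(\<And>i. i \<le> t \<Longrightarrow> b i = c i) \<Longrightarrow> hist x b t = hist x c t"
  by (induction t) auto

text \<open>
  The events are written with \<open>X i \<omega> \<in> b i\<close> rather than \<open>X i \<omega> <# H = b i\<close> so that the step
  property of Markov chains for sets of histories applies directly.
\<close>

lemma hist_eq_prob:
  assumes mc: "is_MC G \<alpha> w M X" and b: "\<And>i. b i \<in> cosets" and g: "g \<in> carrier G"
  shows "hist (real_elem G (pmf \<alpha>)) b t g
    = of_real (\<P>(\<omega> in M. (\<forall>i\<le>t. X i \<omega> \<in> b i) \<and> X t \<omega> = g) * total ^ t)"
  using g
proof (induction t arbitrary: g)
  case 0
  have "{\<omega> \<in> space M. X 0 \<omega> \<in> b 0 \<and> X 0 \<omega> = g}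
      = (if g \<in> b 0 then {\<omega> \<in> space M. X 0 \<omega> = g} else {})" by auto
  then show ?case using 0 mc by (auto simp: proj_def real_elem_def is_MC_def)
next
  case (Suc t)
  have chain: "markov_chain M (carrier G) X (\<lambda>x y. incr (inv x \<otimes> y))"
    using mc by (simp add: is_MC_iff)
  interpret prob_space M using chain by (simp add: markov_chain_def)
  note [measurable] = markov_chain_pred[OF chain]
  show ?case
  proof (cases "g \<in> b (Suc t)")
    case True
    let ?R = "\<lambda>\<omega>. \<forall>i\<le>t. X i \<omega> \<in> b i"
    have "\<P>(\<omega> in M. (\<forall>i\<le>Suc t. X i \<omega> \<in> b i) \<and> X (Suc t) \<omega> = g)
        = \<P>(\<omega> in M. ?R \<omega> \<and> X (Suc t) \<omega> = g)"
      using True by (intro arg_cong[where f = prob] Collect_cong) (auto simp: le_Suc_eq)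
    also have "\<dots> = (\<Sum>x\<in>carrier G. \<P>(\<omega> in M. (?R \<omega> \<and> X (Suc t) \<omega> = g) \<and> X t \<omega> = x))"
      by (rule prob_split) (use markov_chain_state[OF chain] in auto)
    also have "\<dots> = (\<Sum>x\<in>carrier G. \<P>(\<omega> in M. ?R \<omega> \<and> X t \<omega> = x) * incr (inv x \<otimes> g))"
      using markov_chain_step[OF chain _ Suc.prems, of _ t b]
      by (intro sum.cong refl) (simp add: conj_ac)
    finally have step: "\<P>(\<omega> in M. (\<forall>i\<le>Suc t. X i \<omega> \<in> b i) \<and> X (Suc t) \<omega> = g)
      = (\<Sum>x\<in>carrier G. \<P>(\<omega> in M. ?R \<omega> \<and> X t \<omega> = x) * incr (inv x \<otimes> g))" .
    have "hist (real_elem G (pmf \<alpha>)) b (Suc t) g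
        = (\<Sum>x\<in>carrier G. of_real (\<P>(\<omega> in M. ?R \<omega> \<and> X t \<omega> = x) * total ^ t)
            * of_real (w (inv x \<otimes> g)))"
      using True Suc by (simp add: proj_def mult_A real_elem_def)
    also have "\<dots> = of_real (\<Sum>x\<in>carrier G.
        \<P>(\<omega> in M. ?R \<omega> \<and> X t \<omega> = x) * incr (inv x \<otimes> g) * total ^ Suc t)"
      unfolding of_real_sum of_real_mult[symmetric]
      using total_pos by (intro sum.cong refl arg_cong[where f = of_real]) (simp add: incr_def)
    finally show ?thesis by (simp only: step sum_distrib_right)
  next
    case False
    then have "{\<omega> \<in> space M. (\<forall>i\<le>Suc t. X i \<omega> \<in> b i) \<and> X (Suc t) \<omega> = g} = {}" by auto
    then have "\<P>(\<omega> in M. (\<forall>i\<le>Suc t. X i \<omega> \<in> b i) \<and> X (Suc t) \<omega> = g) = 0"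
      by (simp only: measure_empty)
    then show ?thesis using False by (simp add: proj_def del: all_simps)
  qed
qed

lemma sum_hist_eq_prob:
  assumes mc: "is_MC G \<alpha> w M X" and b: "\<And>i. b i \<in> cosets"
  shows "(\<Sum>g\<in>b t. hist (real_elem G (pmf \<alpha>)) b t g)
    = of_real (\<P>(\<omega> in M. \<forall>i\<le>t. X i \<omega> <# H = b i) * total ^ t)"
proof -
  have chain: "markov_chain M (carrier G) X (\<lambda>x y. incr (inv x \<otimes> y))"
    using mc by (simp add: is_MC_iff)
  interpret prob_space M using chain by (simp add: markov_chain_def)
  note [measurable] = markov_chain_pred[OF chain]
  have "\<P>(\<omega> in M. \<forall>i\<le>t. X i \<omega> <# H = b i) = \<P>(\<omega> in M. \<forall>i\<le>t. X i \<omega> \<in> b i)"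
    using markov_chain_state[OF chain] mem_coset_iff[OF b]
    by (intro arg_cong[where f = prob] Collect_cong) auto
  also have "\<dots> = (\<Sum>g\<in>b t. \<P>(\<omega> in M. (\<forall>i\<le>t. X i \<omega> \<in> b i) \<and> X t \<omega> = g))"
    by (rule prob_split) (use b in auto)
  finally show ?thesis
    using hist_eq_prob[OF mc b] coset_carrier[OF b] by (simp add: sum_distrib_right)
qed

lemma coset_process_measurable:
  assumes "markov_chain M (carrier G) X P"
  shows "(\<lambda>\<omega>. X t \<omega> <# H) \<in> M \<rightarrow>\<^sub>M count_space cosets"
proof -
  have "X t \<in> M \<rightarrow>\<^sub>M count_space (carrier G)"
    using assms by (simp add: markov_chain_def)
  moreover have "(\<lambda>x. x <# H) \<in> count_space (carrier G) \<rightarrow>\<^sub>M count_space cosets"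
    by simp
  ultimately show ?thesis by (rule measurable_compose)
qed

text \<open>
  Up to a scalar, a history is the conditional law of the present state given the past cosets, and the lumping equation for a history says that the next coset is
  chosen with the probabilities of \<open>Q_unif\<close>.
\<close>

lemma lumped_chain_if_in_J:
  assumes mc: "is_MC G \<alpha> w M X" and J: "real_elem G (pmf \<alpha>) \<in> J"
  shows "markov_chain M cosets (\<lambda>t \<omega>. X t \<omega> <# H) Q_unif"
proof -
  let ?a = "real_elem G (pmf \<alpha>)"
  have chain: "markov_chain M (carrier G) X (\<lambda>x y. incr (inv x \<otimes> y))"
    using mc by (simp add: is_MC_iff)
  have step: "\<P>(\<omega> in M. \<forall>i\<le>Suc t. X i \<omega> <# H = b i)
      = \<P>(\<omega> in M. \<forall>i\<le>t. X i \<omega> <# H = b i) * Q_unif (b t) (b (Suc t))"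
    if b: "\<And>i. b i \<in> cosets" for b t
  proof -
    have "(\<Sum>g\<in>b (Suc t). hist ?a b (Suc t) g) = (\<Sum>g\<in>b (Suc t). (hist ?a b t \<otimes>\<^bsub>A\<^esub> w_hat) g)"
      by (simp add: proj_def)
    also have "\<dots> = (\<Sum>g\<in>b t. hist ?a b t g) * of_real (flow (b t) (b (Suc t)))"
      using hist_mult_defect_iff[OF b, where x = ?a and t = t] J_D[OF J b] b by simp
    finally have "complex_of_real (\<P>(\<omega> in M. \<forall>i\<le>Suc t. X i \<omega> <# H = b i) * total ^ Suc t)
        = of_real (\<P>(\<omega> in M. \<forall>i\<le>t. X i \<omega> <# H = b i) * total ^ t * flow (b t) (b (Suc t)))"
      unfolding sum_hist_eq_prob[where b = b, OF mc b] by simp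
    then have "\<P>(\<omega> in M. \<forall>i\<le>Suc t. X i \<omega> <# H = b i) * total ^ Suc t
        = \<P>(\<omega> in M. \<forall>i\<le>t. X i \<omega> <# H = b i) * total ^ t * flow (b t) (b (Suc t))"
      by (simp only: of_real_eq_iff)
    then show ?thesis using total_pos by (simp add: Q_unif_def field_simps)
  qed
  have "\<P>(\<omega> in M. X (Suc t) \<omega> <# H = b (Suc t) \<bar> \<forall>i\<le>t. X i \<omega> <# H = b i) = Q_unif (b t) (b (Suc t))"
    if b: "\<forall>i\<le>Suc t. b i \<in> cosets" and pos: "\<P>(\<omega> in M. \<forall>i\<le>t. X i \<omega> <# H = b i) > 0" for b t
  proof -
    \<comment> \<open>Histories ask for cosets at all times, so \<open>b\<close> is continued by \<open>H\<close> after time \<open>t + 1\<close>.\<close>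
    define c where "c = (\<lambda>i. if i \<le> Suc t then b i else H)"
    have c: "c i \<in> cosets" for i using b H_in_cosets by (simp add: c_def)
    have "\<P>(\<omega> in M. X (Suc t) \<omega> <# H = b (Suc t) \<and> (\<forall>i\<le>t. X i \<omega> <# H = b i))
        = \<P>(\<omega> in M. \<forall>i\<le>Suc t. X i \<omega> <# H = c i)"
      by (intro arg_cong[where f = "measure M"] Collect_cong) (auto simp: c_def le_Suc_eq)
    also have "\<dots> = \<P>(\<omega> in M. \<forall>i\<le>t. X i \<omega> <# H = b i) * Q_unif (b t) (b (Suc t))"
      using step[of c t, OF c] by (simp add: c_def cong: conj_cong)
    finally show ?thesis using pos by (simp add: cond_prob_def)
  qed
  then show ?thesis
    using chain coset_process_measurable[OF chain] Q_unif_nonneg Q_unif_sum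
    by (simp add: markov_chain_def)
qed

text \<open>
  At every time \<open>t\<close> the flux from \<open>b\<close> to \<open>c\<close> equals \<open>P b c\<close> times the mass of \<open>b\<close>, which is a
  linear relation on the law of \<open>X t\<close>. It survives averaging over time and passage to the
  limit, and for the uniform law it determines \<open>P b c\<close>, as no coset has mass zero there. The
  argument also covers cosets \<open>b\<close> that are not charged at some times.
\<close>

lemma lumped_transition_unique:
  assumes irr: "irreducible_weight G w" and mc: "is_MC G \<alpha> w M X"
    and lump: "markov_chain M cosets (\<lambda>t \<omega>. X t \<omega> <# H) P"
    and b: "b \<in> cosets" and c: "c \<in> cosets"
  shows "P b c = Q_unif b c"
proof -
  have chain: "markov_chain M (carrier G) X (\<lambda>x y. incr (inv x \<otimes> y))"
    using mc by (simp add: is_MC_iff)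
  interpret prob_space M using chain by (simp add: markov_chain_def)
  note [measurable] = markov_chain_pred[OF chain]
  note state = markov_chain_state[OF chain]
  define \<mu> where "\<mu> = (\<lambda>t g. \<P>(\<omega> in M. X t \<omega> = g))"
  have \<mu>_pair: "\<P>(\<omega> in M. X t \<omega> = x \<and> X (Suc t) \<omega> = y) = \<mu> t x * incr (inv x \<otimes> y)"
    if "x \<in> carrier G" "y \<in> carrier G" for t x y
    using markov_chain_step[OF chain that, of t "\<lambda>_. UNIV"] by (simp add: \<mu>_def)
  have \<mu>_step: "\<mu> (Suc t) y = (\<Sum>x\<in>carrier G. \<mu> t x * incr (inv x \<otimes> y))" if y: "y \<in> carrier G" for t y
  proof -
    have "\<mu> (Suc t) y = (\<Sum>x\<in>carrier G. \<P>(\<omega> in M. X (Suc t) \<omega> = y \<and> X t \<omega> = x))"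
      unfolding \<mu>_def by (rule prob_split) (use state in auto)
    then show ?thesis using \<mu>_pair y by (simp add: conj_commute)
  qed
  have \<mu>_sum: "(\<Sum>g\<in>carrier G. \<mu> t g) = 1" for t
    using prob_split[of "carrier G" "\<lambda>_. True" "X t"] state prob_space by (simp add: \<mu>_def)
  have marg: "\<P>(\<omega> in M. X t \<omega> <# H = b) = (\<Sum>x\<in>b. \<mu> t x)" for t
  proof -
    have "\<P>(\<omega> in M. X t \<omega> <# H = b) = \<P>(\<omega> in M. X t \<omega> \<in> b)"
      using state mem_coset_iff[OF b] by (intro arg_cong[where f = prob] Collect_cong) auto
    also have "\<dots> = (\<Sum>x\<in>b. \<P>(\<omega> in M. X t \<omega> \<in> b \<and> X t \<omega> = x))"
      by (rule prob_split) (use b in auto)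
    also have "\<dots> = (\<Sum>x\<in>b. \<mu> t x)"
      unfolding \<mu>_def by (intro sum.cong refl arg_cong[where f = prob] Collect_cong) auto
    finally show ?thesis .
  qed
  have joint: "\<P>(\<omega> in M. X t \<omega> <# H = b \<and> X (Suc t) \<omega> <# H = c)
      = (\<Sum>x\<in>b. \<Sum>y\<in>c. \<mu> t x * incr (inv x \<otimes> y))" for t
  proof -
    have "\<P>(\<omega> in M. X t \<omega> <# H = b \<and> X (Suc t) \<omega> <# H = c)
        = \<P>(\<omega> in M. X t \<omega> \<in> b \<and> X (Suc t) \<omega> \<in> c)"
      using state mem_coset_iff[OF b] mem_coset_iff[OF c]
      by (intro arg_cong[where f = prob] Collect_cong) auto
    also have "\<dots> = (\<Sum>z\<in>b \<times> c. \<P>(\<omega> in M. (X t \<omega> \<in> b \<and> X (Suc t) \<omega> \<in> c)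
        \<and> (X t \<omega>, X (Suc t) \<omega>) = z))"
      by (rule prob_split) (use b c in auto)
    also have "\<dots> = (\<Sum>z\<in>b \<times> c. case z of (x, y) \<Rightarrow> \<P>(\<omega> in M. X t \<omega> = x \<and> X (Suc t) \<omega> = y))"
      by (auto intro!: sum.cong arg_cong[where f = prob] Collect_cong)
    also have "\<dots> = (\<Sum>x\<in>b. \<Sum>y\<in>c. \<mu> t x * incr (inv x \<otimes> y))"
      unfolding sum.cartesian_product[symmetric]
      by (intro sum.cong refl \<mu>_pair) (use coset_carrier b c in auto)
    finally show ?thesis .
  qed
  let ?d = "\<lambda>x. (\<Sum>y\<in>c. incr (inv x \<otimes> y)) - P b c"
  have balance: "(\<Sum>x\<in>b. \<mu> t x * ?d x) = 0" for t
  proof -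
    have "\<P>(\<omega> in M. X t \<omega> <# H = b \<and> X (Suc t) \<omega> <# H = c)
        = \<P>(\<omega> in M. X t \<omega> <# H = b) * P b c"
      using markov_chain_step[OF lump b c, of t "\<lambda>_. UNIV"] by simp
    then show ?thesis
      by (simp add: joint marg right_diff_distrib sum_subtractf sum_distrib_left sum_distrib_right)
  qed
  have gen: "generate G {g \<in> carrier G. incr g \<noteq> 0} = carrier G"
    using irr total_pos by (simp add: irreducible_weight_def incr_def)
  have "(\<lambda>n. \<Sum>x\<in>b. (\<Sum>t<n. \<mu> t x) / n * ?d x) \<longlonglongrightarrow> (\<Sum>x\<in>b. 1 / card (carrier G) * ?d x)"
    by (intro tendsto_intros cesaro_uniform[where p = incr] incr_nonneg incr_sum gen \<mu>_sum \<mu>_step)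
       (use coset_carrier[OF b] in \<open>auto simp: \<mu>_def\<close>)
  moreover have "(\<Sum>x\<in>b. (\<Sum>t<n. \<mu> t x) / n * ?d x) = 0" for n
  proof -
    have "(\<Sum>x\<in>b. (\<Sum>t<n. \<mu> t x) / n * ?d x) = (\<Sum>t<n. \<Sum>x\<in>b. \<mu> t x * ?d x) / n"
      by (subst sum.swap) (simp add: sum_distrib_right sum_divide_distrib)
    then show ?thesis by (simp add: balance)
  qed
  ultimately have "(\<Sum>x\<in>b. 1 / card (carrier G) * ?d x) = 0"
    by (simp add: LIMSEQ_const_iff)
  then have "(\<Sum>x\<in>b. ?d x) = 0"
    using one_closed finite_carrier by (auto simp: sum_divide_distrib[symmetric])
  then show ?thesis
    using card_H_pos card_coset[OF b] by (simp add: Q_unif_eq sum_subtractf field_simps)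
qed

text \<open>
  The lumping equation for the history \<open>b 0, \<dots>, b t\<close> concerns the mass sent to each coset \<open>c\<close>, so it
  is read off the Markov property for the sequences that continue with \<open>c\<close> at time \<open>t + 1\<close>.
\<close>

lemma in_J_if_lumped_chain:
  assumes irr: "irreducible_weight G w" and mc: "is_MC G \<alpha> w M X"
    and lump: "markov_chain M cosets (\<lambda>t \<omega>. X t \<omega> <# H) P"
  shows "real_elem G (pmf \<alpha>) \<in> J"
proof -
  let ?a = "real_elem G (pmf \<alpha>)"
  have "hist ?a b t \<otimes>\<^bsub>A\<^esub> defect = \<zero>\<^bsub>A\<^esub>" if b: "\<And>i. b i \<in> cosets" for b t
  proof -
    have "(\<Sum>y\<in>c. (hist ?a b t \<otimes>\<^bsub>A\<^esub> w_hat) y) = (\<Sum>k\<in>b t. hist ?a b t k) * of_real (flow (b t) c)"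
      if c: "c \<in> cosets" for c
    proof -
      define b' where "b' = b(Suc t := c)"
      have b': "b' i \<in> cosets" for i using b c by (simp add: b'_def)
      have "hist ?a b t = hist ?a b' t" by (rule hist_cong) (simp add: b'_def)
      moreover have "(\<Sum>y\<in>c. (hist ?a b' t \<otimes>\<^bsub>A\<^esub> w_hat) y) = (\<Sum>y\<in>b' (Suc t). hist ?a b' (Suc t) y)"
        by (simp add: b'_def proj_def)
      moreover have "\<P>(\<omega> in M. \<forall>i\<le>Suc t. X i \<omega> <# H = b' i)
          = \<P>(\<omega> in M. \<forall>i\<le>t. X i \<omega> <# H = b' i) * Q_unif (b t) c"
        using markov_chain_path_step[where y = b' and t = t, OF lump b'] lumped_transition_unique[OF irr mc lump b c]
        by (simp add: b'_def)
      moreover have "total * Q_unif (b t) c = flow (b t) c" using total_pos by (simp add: Q_unif_def)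
      ultimately show ?thesis
        using sum_hist_eq_prob[where b = b' and t = t, OF mc b']
          sum_hist_eq_prob[where b = b' and t = "Suc t", OF mc b']
        by (simp add: b'_def mult_ac flip: of_real_mult)
    qed
    then show ?thesis by (simp add: hist_mult_defect_iff[OF b])
  qed
  moreover have "?a \<in> carrier A" by (simp add: real_elem_def carrier_A)
  ultimately show ?thesis by (simp add: J_def)
qed

text \<open>
  The chain is realised as the sequence of partial products of independent group elements, the first
  distributed as \<open>\<alpha>\<close> and the others proportionally to \<open>w\<close>. A path of the chain is then the same as a
  sequence of increments, so path probabilities are products.
\<close>

lemma exists_MC:
  assumes \<alpha>: "set_pmf \<alpha> \<subseteq> carrier G"
  shows "\<exists>(M :: (nat \<Rightarrow> 'a) measure) X. is_MC G \<alpha> w M X"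
proof -
  define q where "q = embed_pmf (\<lambda>g. if g \<in> carrier G then incr g else 0)"
  have q: "pmf q g = (if g \<in> carrier G then incr g else 0)" for g
    unfolding q_def
  proof (rule pmf_embed_pmf)
    have "(\<integral>\<^sup>+ x. ennreal (if x \<in> carrier G then incr x else 0) \<partial>count_space UNIV)
        = (\<Sum>x\<in>carrier G. ennreal (incr x))"
      by (subst nn_integral_count_space'[of "carrier G"]) auto
    then show "(\<integral>\<^sup>+ x. ennreal (if x \<in> carrier G then incr x else 0) \<partial>count_space UNIV) = 1"
      using incr_nonneg incr_sum by (simp add: sum_ennreal)
  qed (use incr_nonneg in auto)
  define N where "N = (\<lambda>i::nat. measure_pmf (if i = 0 then \<alpha> else q))"
  have N_sets: "sets (N i) = UNIV" for i by (simp add: N_def)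
  define M where "M = Pi\<^sub>M UNIV N"
  interpret product_prob_space N UNIV
    by (rule product_prob_spaceI) (simp add: N_def measure_pmf.prob_space_axioms)
  \<comment> \<open>Increments outside \<open>G\<close> form a null set but are points of the sample space; replacing them by
    the identity makes the chain stay in \<open>G\<close> everywhere.\<close>
  define clip where "clip = (\<lambda>g. if g \<in> carrier G then g else \<one>)"
  define X where "X = rec_nat (\<lambda>\<omega>. clip (\<omega> 0)) (\<lambda>t Xt \<omega>. Xt \<omega> \<otimes> clip (\<omega> (Suc t)))"
  have X0: "X 0 \<omega> = clip (\<omega> 0)" and XSuc: "X (Suc t) \<omega> = X t \<omega> \<otimes> clip (\<omega> (Suc t))" for t \<omega>
    by (simp_all add: X_def)
  have clip: "clip g \<in> carrier G" for g by (simp add: clip_def)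
  \<comment> \<open>The increments that produce the path \<open>x\<close>.\<close>
  define D where "D = (\<lambda>(x :: nat \<Rightarrow> 'a) i. case i of 0 \<Rightarrow> x 0 | Suc j \<Rightarrow> inv (x j) \<otimes> x i)"
  have D_closed: "D x i \<in> carrier G" if "\<And>j. j \<le> i \<Longrightarrow> x j \<in> carrier G" for x i
    using that by (cases i) (simp_all add: D_def)
  have path: "(\<forall>i\<le>t. X i \<omega> = x i) \<longleftrightarrow> (\<forall>i\<in>{..t}. \<omega> i \<in> clip -` {D x i})"
    if x: "\<And>i. i \<le> t \<Longrightarrow> x i \<in> carrier G" for x t \<omega>
    using x
  proof (induction t)
    case (Suc t)
    have "x t \<otimes> clip (\<omega> (Suc t)) = x (Suc t) \<longleftrightarrow> clip (\<omega> (Suc t)) = inv (x t) \<otimes> x (Suc t)"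
      using cancel_inverse Suc.prems[of t] Suc.prems[of "Suc t"] clip[of "\<omega> (Suc t)"]
      by (metis le_SucI order_refl)
    then have "X t \<omega> = x t \<Longrightarrow> X (Suc t) \<omega> = x (Suc t) \<longleftrightarrow> clip (\<omega> (Suc t)) = D x (Suc t)"
      by (simp add: XSuc D_def)
    moreover have "(\<forall>i\<le>t. X i \<omega> = x i) \<longleftrightarrow> (\<forall>i\<in>{..t}. \<omega> i \<in> clip -` {D x i})"
      using Suc by simp
    ultimately show ?case
      by (auto simp: le_Suc_eq)
  qed (simp add: X0 D_def)
  have clip_prob: "measure (N i) (clip -` {g}) = (if i = 0 then pmf \<alpha> g else incr g)"
    if g: "g \<in> carrier G" for i g
  proof -
    have sub: "set_pmf (if i = 0 then \<alpha> else q) \<subseteq> carrier G"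
      using \<alpha> by (auto simp: set_pmf_eq q)
    have "measure (N i) (clip -` {g}) = measure (N i) {g}"
      unfolding N_def by (rule measure_pmf.finite_measure_eq_AE)
        (use sub g in \<open>auto simp: AE_measure_pmf_iff clip_def\<close>)
    then show ?thesis using g by (simp add: N_def measure_pmf_single q)
  qed
  have prob: "\<P>(\<omega> in M. \<forall>i\<le>t. X i \<omega> = x i)
      = (\<Prod>i\<le>t. if i = 0 then pmf \<alpha> (D x i) else incr (D x i))"
    if x: "\<And>i. i \<le> t \<Longrightarrow> x i \<in> carrier G" for x t
  proof -
    have "{\<omega> \<in> space M. \<forall>i\<le>t. X i \<omega> = x i}
        = prod_emb UNIV N {..t} (\<Pi>\<^sub>E i\<in>{..t}. clip -` {D x i})"
      using path[of t x, OF x] by (auto simp: M_def prod_emb_def space_PiM N_def Pi_iff)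
    then have "\<P>(\<omega> in M. \<forall>i\<le>t. X i \<omega> = x i) = (\<Prod>i\<le>t. measure (N i) (clip -` {D x i}))"
      unfolding M_def by (simp add: measure_PiM_emb N_sets)
    also have "\<dots> = (\<Prod>i\<le>t. if i = 0 then pmf \<alpha> (D x i) else incr (D x i))"
      using D_closed x by (intro prod.cong refl clip_prob) simp
    finally show ?thesis .
  qed
  have meas: "X t \<in> M \<rightarrow>\<^sub>M count_space (carrier G)" for t
  proof -
    have comp: "(\<lambda>\<omega>. clip (\<omega> i)) \<in> M \<rightarrow>\<^sub>M count_space (carrier G)" for i
    proof -
      have "(\<lambda>\<omega>. \<omega> i) \<in> M \<rightarrow>\<^sub>M N i" unfolding M_def by (rule measurable_component_singleton) simp
      moreover have "clip \<in> N i \<rightarrow>\<^sub>M count_space (carrier G)" using clip by (simp add: N_def)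
      ultimately show ?thesis by (rule measurable_compose)
    qed
    show ?thesis
    proof (induction t)
      case 0
      then show ?case using comp[of 0] by (simp add: X0[abs_def])
    next
      case (Suc t)
      have "(\<lambda>\<omega>. (\<lambda>x \<omega>. x \<otimes> clip (\<omega> (Suc t))) (X t \<omega>) \<omega>) \<in> M \<rightarrow>\<^sub>M count_space (carrier G)"
      proof (rule measurable_compose_countable'[OF _ Suc])
        fix x assume x: "x \<in> carrier G"
        then have "(\<lambda>y. x \<otimes> y) \<in> count_space (carrier G) \<rightarrow>\<^sub>M count_space (carrier G)" by simp
        from measurable_compose[OF comp this]
        show "(\<lambda>\<omega>. x \<otimes> clip (\<omega> (Suc t))) \<in> M \<rightarrow>\<^sub>M count_space (carrier G)" .
      qed (simp add: countable_finite)
      then show ?case by (simp add: XSuc[abs_def])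
    qed
  qed
  have "markov_chain M (carrier G) X (\<lambda>x y. incr (inv x \<otimes> y))"
    unfolding markov_chain_def
  proof (intro conjI allI impI ballI)
    show "prob_space M" unfolding M_def by (rule P.prob_space_axioms)
    show "X t \<in> M \<rightarrow>\<^sub>M count_space (carrier G)" for t by (rule meas)
    fix x assume x: "x \<in> carrier G"
    show "(\<Sum>y\<in>carrier G. incr (inv x \<otimes> y)) = 1"
      using sum_translate[of "inv x" incr] x incr_sum by simp
    show "0 \<le> incr (inv x \<otimes> y)" if "y \<in> carrier G" for y using x that by (simp add: incr_nonneg)
  next
    fix t :: nat and y :: "nat \<Rightarrow> 'a"
    assume y: "\<forall>i\<le>Suc t. y i \<in> carrier G" and pos: "0 < \<P>(\<omega> in M. \<forall>i\<le>t. X i \<omega> = y i)"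
    have "{\<omega> \<in> space M. X (Suc t) \<omega> = y (Suc t) \<and> (\<forall>i\<le>t. X i \<omega> = y i)}
        = {\<omega> \<in> space M. \<forall>i\<le>Suc t. X i \<omega> = y i}"
      by (auto simp: le_Suc_eq)
    moreover have "\<P>(\<omega> in M. \<forall>i\<le>Suc t. X i \<omega> = y i)
        = \<P>(\<omega> in M. \<forall>i\<le>t. X i \<omega> = y i) * incr (inv (y t) \<otimes> y (Suc t))"
      using prob[of "Suc t" y] prob[of t y] y by (simp add: D_def)
    ultimately show "\<P>(\<omega> in M. X (Suc t) \<omega> = y (Suc t) \<bar> \<forall>i\<le>t. X i \<omega> = y i)
        = incr (inv (y t) \<otimes> y (Suc t))"
      using pos by (simp add: cond_prob_def)
  qed simp
  moreover have "\<P>(\<omega> in M. X 0 \<omega> = x) = pmf \<alpha> x" if "x \<in> carrier G" for x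
    using prob[of 0 "\<lambda>_. x"] that by (simp add: D_def)
  ultimately show ?thesis unfolding is_MC_iff by blast
qed

lemma lumps_weakly_iff_in_J:
  assumes "irreducible_weight G w" "set_pmf \<alpha> \<subseteq> carrier G"
  shows "lumps_weakly G H \<alpha> w \<longleftrightarrow> real_elem G (pmf \<alpha>) \<in> J"
proof
  assume "lumps_weakly G H \<alpha> w"
  then show "real_elem G (pmf \<alpha>) \<in> J"
    using in_J_if_lumped_chain[OF assms(1)] unfolding lumps_weakly_def by blast
next
  assume J: "real_elem G (pmf \<alpha>) \<in> J"
  obtain M :: "(nat \<Rightarrow> 'a) measure" and X where mc: "is_MC G \<alpha> w M X"
    using exists_MC[OF assms(2)] by blast
  with lumped_chain_if_in_J[OF mc J] show "lumps_weakly G H \<alpha> w"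
    unfolding lumps_weakly_def by blast
qed

end

theorem theorem1p7:
  fixes G :: "('a, 'b) monoid_scheme" and H :: "'a set"
    and w :: "'a \<Rightarrow> real" and \<alpha> :: "'a pmf"
  assumes "group G" and "finite (carrier G)" and "subgroup H G"
    and "weight G w" and "irreducible_weight G w" and "weakly_lumping G H w"
    and "set_pmf \<alpha> \<subseteq> carrier G"
  shows "lumps_weakly G H \<alpha> w \<longleftrightarrow> real_elem G (pmf \<alpha>) \<in> J_ideal G H w"
proof -
  interpret weighted_lumping G H w
    using assms
    by (simp add: weighted_lumping_def coset_lumping_def finite_group_def finite_group_axioms_def
        coset_lumping_axioms_def weighted_lumping_axioms_def)
  obtain \<beta> where \<beta>: "set_pmf \<beta> \<subseteq> carrier G" "lumps_weakly G H \<beta> w"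
    using assms(6) unfolding weakly_lumping_def by blast
  have "(\<Sum>g\<in>carrier G. pmf \<beta> g) = 1"
    using \<beta>(1) by (simp add: sum_pmf_eq_1)
  then have "(\<Sum>g\<in>carrier G. real_elem G (pmf \<beta>) g) = 1"
    by (simp add: real_elem_def flip: of_real_sum)
  moreover have "real_elem G (pmf \<beta>) \<in> J"
    using lumps_weakly_iff_in_J[OF assms(5)] \<beta> by blast
  ultimately have "J_ideal G H w = J"
    by (intro J_ideal_eq eta_carrier_in_J)
  then show ?thesis
    using lumps_weakly_iff_in_J[OF assms(5,7)] by simp
qed

end
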